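(* Let $\boldsymbol\lambda=(\lambda^{(1)},\ldots,\lambda^{(k)})$ be a tuple of partitions and $\mathbf d=(d_1,\ldots,d_k)$ a tuple of positive integers with $d_i\geq \ell(\lambda^{(i)})$ for all $i$, and let $n$ be large enough that $\lambda^{(i)}_1\le n-d_i$ for all $i$. Then \[\mathfrak A_{\boldsymbol\lambda,\mathbf d}=\sum_{w\in{\tt MinPerm}(A_{\boldsymbol\lambda,\mathbf d})}\mathfrak S_w,\] where $\mathfrak S_w$ denotes the Schubert polynomial of Lascoux–Schützenberger.
   Context: An alternating sign matrix (ASM) of size $n$ is an $n\times n$ matrix with entries in $\{-1,0,1\}$ such that the nonzero entries of each row and column alternate in sign and each row and column sums to $1$; ${\sf ASM}(n)$ is the set of these. For $A=(a_{ij})$ its corner sum function is $r_A(i,j)=\sum_{k\le i}\sum_{l\le j}a_{kl}$. Order: $A\le B$ iff $r_A(i,j)\ge r_B(i,j)$ for all $i,j$. This makes ${\sf ASM}(n)$ a lattice; the join $\vee$ of a set of ASMs is the ASM whose corner sum function is the entrywise minimum of their corner sum functions. A permutation $w\in\mathcal S_n$ is identified with its permutation matrix (a $1$ in each position $(i,w(i))$); on $\mathcal S_n$ the order is Bruhat order. $\ell(w)$ is the number of inversions of $w$. For $A\in{\sf ASM}(n)$, ${\tt deg}(A)=\min\{\ell(w):w\in\mathcal S_n, w\ge A\}$, ${\tt Perm}(A)$ is the set of minimal elements of $\{w\in\mathcal S_n:w\ge A\}$, and ${\tt MinPerm}(A)=\{w\in{\tt Perm}(A):\ell(w)={\tt deg}(A)\}$.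 For a partition $\lambda$ with $\ell(\lambda)\le d$ and $\lambda_1\le n-d$, $[\lambda,d]_g\in\mathcal S_n$ is the permutation $u$ with $u(k)=\lambda_{d-k+1}+k$ for $1\le k\le d$ and $u(d+1)<\cdots<u(n)$ the remaining values (if $\lambda$ is empty, $[\lambda,d]_g$ is the identity). Define $A_{\boldsymbol\lambda,\mathbf d}=\vee\{[\lambda^{(1)},d_1]_g,\ldots,[\lambda^{(k)},d_k]_g\}\in{\sf ASM}(n)$. Prism tableaux: use matrix coordinates $(a,b)$ (row $a$ from the top, column $b$ from the left) in $\mathbb Z_{>0}\times\mathbb Z_{>0}$. Place $\lambda^{(c)}$ as the set of cells $\{(a,b):1\le a\le d_c,\ 1\le b\le \lambda^{(c)}_{d_c-a+1}\}$ (so its longest row is row $d_c$). A prism tableau for $(\boldsymbol\lambda,\mathbf d)$ is a tuple $\mathcal T=(T^{(1)},\ldots,T^{(k)})$ where $T^{(c)}$ ("color $c$") fills the cells of $\lambda^{(c)}$ with integers in $\{1,\ldots,d_c\}$ that weakly decrease along rows from left to right and strictly decrease along columns from bottom to top. An antidiagonal is a set $\{(a,b):a+b=s\}$. The weight is ${\tt wt}(\mathcal T)=\prod_m x_m^{n_m}$ where $n_m$ is the number of antidiagonals containing an entry equal to $m$ (of any color). $\mathcal T$ is minimal if the total degree of ${\tt wt}(\mathcal T)$ is the minimum over all prism tableaux for $(\boldsymbol\lambda,\mathbf d)$. $\mathcal T$ has an unstable triple if, in some antidiagonal, there are an entry $\ell$ of color $c$, another entry $\ell$ of a color $d\neq c$,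 and an entry $\ell'$ (of some color $e$) with $\ell<\ell'$, such that replacing that entry $\ell$ of color $c$ by $\ell'$ yields again a prism tableau. ${\tt Prism}(\boldsymbol\lambda,\mathbf d)$ is the set of minimal prism tableaux with no unstable triples, and $\mathfrak A_{\boldsymbol\lambda,\mathbf d}=\sum_{\mathcal T\in{\tt Prism}(\boldsymbol\lambda,\mathbf d)}{\tt wt}(\mathcal T)$. *)

theory Defs
  imports
    "HOL-Library.Poly_Mapping"
    "HOL-Combinatorics.Permutations"
    "Jordan_Normal_Form.Matrix"
begin

section \<open>Integer polynomials in the variables \<open>x\<^sub>1, x\<^sub>2, \<dots>\<close>\<close>

text \<open>A polynomial is a finitely supported map from exponent vectors to coefficients; the ring
  structure is that of \<^theory>\<open>HOL-Library.Poly_Mapping\<close>. The index 0 is not used as a variable.\<close>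

type_synonym zpoly = "(nat \<Rightarrow>\<^sub>0 nat) \<Rightarrow>\<^sub>0 int"

definition x_var :: "nat \<Rightarrow> zpoly" where
  "x_var i = Poly_Mapping.single (Poly_Mapping.single i 1) 1"

definition total_degree :: "zpoly \<Rightarrow> nat" where
  "total_degree f =
     Max (insert 0 ((\<lambda>e. \<Sum>m\<in>Poly_Mapping.keys e. Poly_Mapping.lookup e m) ` Poly_Mapping.keys f))"

text \<open>The outer map substitutes in the exponent vector: the coefficient of \<open>e\<close> in \<open>swap_vars i f\<close> is
  the coefficient in \<open>f\<close> of \<open>e\<close> with the entries \<open>i\<close> and \<open>i + 1\<close> exchanged.\<close>

definition swap_vars :: "nat \<Rightarrow> zpoly \<Rightarrow> zpoly" where
  "swap_vars i = Poly_Mapping.map_key (Poly_Mapping.map_key (transpose i (Suc i)))"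

text \<open>\<open>\<partial>\<^sub>i f = (f - s\<^sub>i f) / (x\<^sub>i - x\<^sub>i\<^sub>+\<^sub>1)\<close>; the quotient exists in the polynomial ring and is unique.\<close>

definition divided_difference :: "nat \<Rightarrow> zpoly \<Rightarrow> zpoly" where
  "divided_difference i f = (THE g. (x_var i - x_var (Suc i)) * g = f - swap_vars i f)"


section \<open>Permutations and Schubert polynomials\<close>

text \<open>\<open>\<S>\<^sub>n\<close> is rendered as \<open>{w. w permutes {1..n}}\<close>.\<close>

definition inv_length :: "nat \<Rightarrow> (nat \<Rightarrow> nat) \<Rightarrow> nat" where
  "inv_length n w = card {(i, j). 1 \<le> i \<and> i < j \<and> j \<le> n \<and> w j < w i}"

definition longest_perm :: "nat \<Rightarrow> nat \<Rightarrow> nat" where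
  "longest_perm n i = (if i \<in> {1..n} then n + 1 - i else i)"

text \<open>\<open>\<SS>\<^sub>w\<close> is obtained from \<open>\<SS>\<^bsub>w\<^sub>0\<^esub> = x\<^sub>1\<^sup>n\<^sup>-\<^sup>1 x\<^sub>2\<^sup>n\<^sup>-\<^sup>2 \<cdots> x\<^sub>n\<^sub>-\<^sub>1\<close> by
  \<open>\<SS>\<^bsub>w s\<^sub>i\<^esub> = \<partial>\<^sub>i \<SS>\<^sub>w\<close> whenever \<open>w(i) > w(i + 1)\<close>, where \<open>w s\<^sub>i\<close> exchanges the values at positions
  \<open>i\<close> and \<open>i + 1\<close>. The relation leaves the chain of descents free; the result does not depend on it.\<close>

inductive schubert_rel :: "nat \<Rightarrow> (nat \<Rightarrow> nat) \<Rightarrow> zpoly \<Rightarrow> bool" for n :: nat where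
  longest: "schubert_rel n (longest_perm n) (\<Prod>i\<in>{1..n}. x_var i ^ (n - i))"
| descent: "\<lbrakk>schubert_rel n w f; 1 \<le> i; i < n; w (Suc i) < w i\<rbrakk>
    \<Longrightarrow> schubert_rel n (w \<circ> transpose i (Suc i)) (divided_difference i f)"

definition schubert :: "nat \<Rightarrow> (nat \<Rightarrow> nat) \<Rightarrow> zpoly" where
  "schubert n w = (THE f. schubert_rel n w f)"


section \<open>Alternating sign matrices\<close>

text \<open>Library matrices are indexed from 0, so the entry \<open>a\<^sub>i\<^sub>j\<close> with \<open>1 \<le> i, j \<le> n\<close> is
  \<open>A $$ (i - 1, j - 1)\<close>.\<close>

definition alternating_sign_vec :: "int vec \<Rightarrow> bool" where
  "alternating_sign_vec v \<longleftrightarrow>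
     (\<forall>j<dim_vec v. v $ j \<in> {-1, 0, 1}) \<and>
     (\<forall>j j'. j < j' \<and> j' < dim_vec v \<and> v $ j \<noteq> 0 \<and> v $ j' \<noteq> 0 \<and> (\<forall>l. j < l \<and> l < j' \<longrightarrow> v $ l = 0)
        \<longrightarrow> v $ j' = - v $ j) \<and>
     (\<Sum>j<dim_vec v. v $ j) = 1"

definition ASM :: "nat \<Rightarrow> int mat set" where
  "ASM n = {A \<in> carrier_mat n n.
     (\<forall>i<n. alternating_sign_vec (row A i)) \<and> (\<forall>j<n. alternating_sign_vec (col A j))}"

text \<open>The arguments of \<open>corner_sum\<close> are the 1-based ones: it sums over the first \<open>i\<close> rows and
  the first \<open>j\<close> columns.\<close>

definition corner_sum :: "int mat \<Rightarrow> nat \<Rightarrow> nat \<Rightarrow> int" where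
  "corner_sum A i j = (\<Sum>k<i. \<Sum>l<j. A $$ (k, l))"

definition asm_le :: "nat \<Rightarrow> int mat \<Rightarrow> int mat \<Rightarrow> bool" where
  "asm_le n A B \<longleftrightarrow> (\<forall>i\<in>{1..n}. \<forall>j\<in>{1..n}. corner_sum A i j \<ge> corner_sum B i j)"

text \<open>Intended for nonempty \<open>S\<close> only.\<close>

definition asm_join :: "nat \<Rightarrow> int mat set \<Rightarrow> int mat" where
  "asm_join n S = (THE C. C \<in> ASM n \<and>
     (\<forall>i\<in>{1..n}. \<forall>j\<in>{1..n}. corner_sum C i j = Min ((\<lambda>A. corner_sum A i j) ` S)))"

definition perm_mat :: "nat \<Rightarrow> (nat \<Rightarrow> nat) \<Rightarrow> int mat" where
  "perm_mat n w = mat n n (\<lambda>(i, j). if w (Suc i) = Suc j then 1 else 0)"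

text \<open>Bruhat order on \<open>\<S>\<^sub>n\<close> is the restriction of the order on alternating sign matrices.\<close>

definition bruhat_le :: "nat \<Rightarrow> (nat \<Rightarrow> nat) \<Rightarrow> (nat \<Rightarrow> nat) \<Rightarrow> bool" where
  "bruhat_le n v w \<longleftrightarrow> asm_le n (perm_mat n v) (perm_mat n w)"

definition perms_above :: "nat \<Rightarrow> int mat \<Rightarrow> (nat \<Rightarrow> nat) set" where
  "perms_above n A = {w. w permutes {1..n} \<and> asm_le n A (perm_mat n w)}"

definition asm_deg :: "nat \<Rightarrow> int mat \<Rightarrow> nat" where
  "asm_deg n A = Min (inv_length n ` perms_above n A)"

definition Perm :: "nat \<Rightarrow> int mat \<Rightarrow> (nat \<Rightarrow> nat) set" where
  "Perm n A = {w \<in> perms_above n A. \<forall>v\<in>perms_above n A. bruhat_le n v w \<longrightarrow> v = w}"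

definition MinPerm :: "nat \<Rightarrow> int mat \<Rightarrow> (nat \<Rightarrow> nat) set" where
  "MinPerm n A = {w \<in> Perm n A. inv_length n w = asm_deg n A}"


section \<open>Partitions and Grassmannian permutations\<close>

text \<open>A partition is the list of its positive parts, so \<open>length lam\<close> is the number of parts;
  \<open>part lam i\<close> is the \<open>i\<close>-th part for \<open>i \<ge> 1\<close>, padded by zeros.\<close>

definition is_partition :: "nat list \<Rightarrow> bool" where
  "is_partition lam \<longleftrightarrow> sorted_wrt (\<ge>) lam \<and> 0 \<notin> set lam"

definition part :: "nat list \<Rightarrow> nat \<Rightarrow> nat" where
  "part lam i = (if 1 \<le> i \<and> i \<le> length lam then lam ! (i - 1) else 0)"

definition grass_perm :: "nat \<Rightarrow> nat list \<Rightarrow> nat \<Rightarrow> nat \<Rightarrow> nat" where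
  "grass_perm n lam d = (THE u. u permutes {1..n} \<and>
     (\<forall>k\<in>{1..d}. u k = part lam (d - k + 1) + k) \<and>
     strict_mono_on {d+1..n} u)"

definition prism_asm :: "nat \<Rightarrow> nat list list \<Rightarrow> nat list \<Rightarrow> int mat" where
  "prism_asm n lams ds =
     asm_join n ((\<lambda>c. perm_mat n (grass_perm n (lams ! c) (ds ! c))) ` {..<length lams})"


section \<open>Prism tableaux\<close>

definition cells :: "nat list \<Rightarrow> nat \<Rightarrow> (nat \<times> nat) set" where
  "cells lam d = {(a, b). 1 \<le> a \<and> a \<le> d \<and> 1 \<le> b \<and> b \<le> part lam (d - a + 1)}"

text \<open>A filling is a total function on positions; it is set to 0 outside its shape, so that a
  filling of the cells corresponds to exactly one function. Rows are numbered downwards, hence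
  entries increase with the row index.\<close>

definition color_tableau :: "nat list \<Rightarrow> nat \<Rightarrow> (nat \<times> nat \<Rightarrow> nat) \<Rightarrow> bool" where
  "color_tableau lam d T \<longleftrightarrow>
     (\<forall>p\<in>cells lam d. T p \<in> {1..d}) \<and>
     (\<forall>p. p \<notin> cells lam d \<longrightarrow> T p = 0) \<and>
     (\<forall>a b b'. (a, b) \<in> cells lam d \<and> (a, b') \<in> cells lam d \<and> b < b' \<longrightarrow> T (a, b') \<le> T (a, b)) \<and>
     (\<forall>a a' b. (a, b) \<in> cells lam d \<and> (a', b) \<in> cells lam d \<and> a < a' \<longrightarrow> T (a, b) < T (a', b))"

text \<open>Colors are numbered from 0, as list positions.\<close>

definition prism_tableau :: "nat list list \<Rightarrow> nat list \<Rightarrow> (nat \<times> nat \<Rightarrow> nat) list \<Rightarrow> bool" where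
  "prism_tableau lams ds T \<longleftrightarrow> length T = length lams \<and>
     (\<forall>c<length lams. color_tableau (lams ! c) (ds ! c) (T ! c))"

definition has_entry ::
    "nat list list \<Rightarrow> nat list \<Rightarrow> (nat \<times> nat \<Rightarrow> nat) list \<Rightarrow> nat \<Rightarrow> nat \<Rightarrow> bool" where
  "has_entry lams ds T s m \<longleftrightarrow>
     (\<exists>c<length lams. \<exists>(a, b)\<in>cells (lams ! c) (ds ! c). a + b = s \<and> (T ! c) (a, b) = m)"

definition antidiag_count ::
    "nat list list \<Rightarrow> nat list \<Rightarrow> (nat \<times> nat \<Rightarrow> nat) list \<Rightarrow> nat \<Rightarrow> nat" where
  "antidiag_count lams ds T m = card {s. has_entry lams ds T s m}"

definition prism_wt ::
    "nat list list \<Rightarrow> nat list \<Rightarrow> (nat \<times> nat \<Rightarrow> nat) list \<Rightarrow> zpoly" where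
  "prism_wt lams ds T =
     (\<Prod>m\<in>{m. \<exists>s. has_entry lams ds T s m}. x_var m ^ antidiag_count lams ds T m)"

definition minimal_prism ::
    "nat list list \<Rightarrow> nat list \<Rightarrow> (nat \<times> nat \<Rightarrow> nat) list \<Rightarrow> bool" where
  "minimal_prism lams ds T \<longleftrightarrow> prism_tableau lams ds T \<and>
     (\<forall>T'. prism_tableau lams ds T' \<longrightarrow>
        total_degree (prism_wt lams ds T) \<le> total_degree (prism_wt lams ds T'))"

definition unstable_triple ::
    "nat list list \<Rightarrow> nat list \<Rightarrow> (nat \<times> nat \<Rightarrow> nat) list \<Rightarrow> bool" where
  "unstable_triple lams ds T \<longleftrightarrow>
     (\<exists>c d e p q r. c < length lams \<and> d < length lams \<and> e < length lams \<and> c \<noteq> d \<and>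
        p \<in> cells (lams ! c) (ds ! c) \<and> q \<in> cells (lams ! d) (ds ! d) \<and>
        r \<in> cells (lams ! e) (ds ! e) \<and>
        fst p + snd p = fst q + snd q \<and> fst p + snd p = fst r + snd r \<and>
        (T ! c) p = (T ! d) q \<and> (T ! c) p < (T ! e) r \<and>
        prism_tableau lams ds (T[c := (T ! c)(p := (T ! e) r)]))"

definition Prism :: "nat list list \<Rightarrow> nat list \<Rightarrow> (nat \<times> nat \<Rightarrow> nat) list set" where
  "Prism lams ds = {T. minimal_prism lams ds T \<and> \<not> unstable_triple lams ds T}"

definition prism_poly :: "nat list list \<Rightarrow> nat list \<Rightarrow> zpoly" where
  "prism_poly lams ds = (\<Sum>T\<in>Prism lams ds. prism_wt lams ds T)"

end

theory Submission
  imports Defs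
begin

text \<open>
  A color-\<open>c\<close> entry \<open>m\<close> on the antidiagonal \<open>a + b = s\<close> is read as a pipe dream cross in row \<open>m\<close>
  contributing the simple transposition with index \<open>s - 1\<close>, so a prism tableau \<open>T\<close> gives a set
  \<open>X(T)\<close> of crosses whose weight is the weight of \<open>T\<close>. Let \<open>P\<close> be any set of crosses and \<open>w\<close> the
  Demazure product of its reading word. Following the values in positions \<open>1, \<dots>, d\<close> through the
  word as particles that hop to the right, one sees that \<open>w\<close> lies above the Grassmannian permutation
  of \<open>(\<lambda>, d)\<close> in Bruhat order iff some tableau of shape \<open>\<lambda>\<close> has all its crosses in \<open>P\<close>: the
  entries of the tableau are the rows in which the particles hop. Hence \<open>w\<close> is above the join \<open>A\<close>
  iff \<open>P\<close> contains \<open>X(T)\<close> for some prism tableau \<open>T\<close>, the minimal size of such a \<open>P\<close> is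
  \<open>deg(A)\<close>, and the \<open>P\<close> of that size are exactly the reduced pipe dreams of the permutations in
  \<open>MinPerm(A)\<close>. The right-hand side is their generating function by the pipe dream formula for
  Schubert polynomials, for which the nilCoxeter argument of Fomin and Stanley is used. Each minimal
  \<open>P\<close> is \<open>X(T)\<close> for exactly one \<open>T\<close> without unstable triples: for every color the tableaux with
  crosses in \<open>P\<close> have an entrywise greatest element, and any smaller tableau has an entry that can be
  raised.
\<close>

text \<open>The Demazure product, unlike the notion of a reduced word, makes sense for every cross
  set, and its length is at most \<open>card P\<close>. For \<open>P\<close> whose product lies
  above \<open>A\<close> this gives deg(A) \<le> length \<le> \<open>card P\<close>; at size deg(A)
  both are equalities and the word is reduced. That such a \<open>P\<close> exists needs a pipe
  dream for every permutation. None is built by hand: if a coefficient of the generating function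
  vanished, divided differences of zero would make the coefficient at \<open>id\<close> vanish, but
  it is 1. Particles suffice because a Grassmannian permutation has at most one descent, at
  \<open>d\<close>, so comparison with it sees only the set w{1..d}, and a letter acting on the left
  moves at most one element of that set by one step. Unstable triples are exactly the obstruction to
  raising entries: a raise towards the greatest tableau either removes the old cross from X(T),
  against minimality, or another color keeps that cross, and then the two entries and the raised
  value form an unstable triple.\<close>

section \<open>The nilCoxeter algebra\<close>

text \<open>A function on permutations stands for an element of the nilCoxeter algebra with these
  coefficients; \<open>nil_act i\<close> is right multiplication by the generator \<open>u\<^sub>i\<close>.\<close>

definition nil_act :: "nat \<Rightarrow> ((nat \<Rightarrow> nat) \<Rightarrow> zpoly) \<Rightarrow> (nat \<Rightarrow> nat) \<Rightarrow> zpoly" where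
  "nil_act i f w = (if w (Suc i) < w i then f (w \<circ> transpose i (Suc i)) else 0)"

definition nil_factor :: "nat \<Rightarrow> zpoly \<Rightarrow> ((nat \<Rightarrow> nat) \<Rightarrow> zpoly) \<Rightarrow> (nat \<Rightarrow> nat) \<Rightarrow> zpoly" where
  "nil_factor i x f w = f w + x * nil_act i f w"

lemma nil_act_square: "nil_act i (nil_act i f) = (\<lambda>w. 0)"
  by (auto simp: nil_act_def fun_eq_iff)

lemma nil_act_comm:
  assumes "Suc i < j"
  shows "nil_act i (nil_act j f) = nil_act j (nil_act i f)"
proof
  fix w :: "nat \<Rightarrow> nat"
  have "(w \<circ> transpose i (Suc i)) \<circ> transpose j (Suc j) = (w \<circ> transpose j (Suc j)) \<circ> transpose i (Suc i)"
    using assms by (auto simp: fun_eq_iff transpose_def)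
  then show "nil_act i (nil_act j f) w = nil_act j (nil_act i f) w"
    using assms by (auto simp: nil_act_def transpose_def)
qed

lemma nil_act_braid:
  "nil_act i (nil_act (Suc i) (nil_act i f)) = nil_act (Suc i) (nil_act i (nil_act (Suc i) f))"
proof
  fix w :: "nat \<Rightarrow> nat"
  have "((w \<circ> transpose i (Suc i)) \<circ> transpose (Suc i) (Suc (Suc i))) \<circ> transpose i (Suc i) =
      ((w \<circ> transpose (Suc i) (Suc (Suc i))) \<circ> transpose i (Suc i)) \<circ> transpose (Suc i) (Suc (Suc i))"
    by (auto simp: fun_eq_iff transpose_def)
  then show "nil_act i (nil_act (Suc i) (nil_act i f)) w =
      nil_act (Suc i) (nil_act i (nil_act (Suc i) f)) w"
    by (auto simp: nil_act_def transpose_def)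
qed

lemma nil_act_linear:
  "nil_act i (\<lambda>w. f w + g w) = (\<lambda>w. nil_act i f w + nil_act i g w)"
  "nil_act i (\<lambda>w. f w - g w) = (\<lambda>w. nil_act i f w - nil_act i g w)"
  "nil_act i (\<lambda>w. c * f w) = (\<lambda>w. c * nil_act i f w)"
  "nil_act i (\<lambda>w. 0) = (\<lambda>w. 0)"
  by (auto simp: nil_act_def fun_eq_iff)

lemma nil_factor_alt: "nil_factor i x f = (\<lambda>w. f w + x * nil_act i f w)"
  by (auto simp: nil_factor_def fun_eq_iff)

lemma nil_factor_linear:
  "nil_factor i x (\<lambda>w. f w - g w) = (\<lambda>w. nil_factor i x f w - nil_factor i x g w)"
  "nil_factor i x (\<lambda>w. c * f w) = (\<lambda>w. c * nil_factor i x f w)"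
  by (auto simp: nil_factor_alt nil_act_linear fun_eq_iff algebra_simps)

lemma nil_factor_add: "nil_factor i y (nil_factor i x f) = nil_factor i (x + y) f"
  by (auto simp: nil_factor_alt nil_act_linear nil_act_square fun_eq_iff algebra_simps)

lemma nil_factor_0: "nil_factor i 0 f = f"
  by (simp add: nil_factor_alt)

lemma nil_factor_comm:
  assumes "Suc i < j"
  shows "nil_factor i x (nil_factor j y f) = nil_factor j y (nil_factor i x f)"
  by (auto simp: nil_factor_alt nil_act_linear nil_act_comm[OF assms] fun_eq_iff algebra_simps)

text \<open>The middle parameter has to be the sum of the outer two for the linear terms to agree.
  The quadratic terms then match because u_i squared is 0, and the cubic terms match by the braid
  relation.\<close>

lemma nil_factor_yang_baxter:
  "nil_factor i x (nil_factor (Suc i) (x + y) (nil_factor i y f)) =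
   nil_factor (Suc i) y (nil_factor i (x + y) (nil_factor (Suc i) x f))"
  by (auto simp: nil_factor_alt nil_act_linear nil_act_square nil_act_braid fun_eq_iff algebra_simps)

text \<open>Operators act from the right, so \<open>nil_row n i x\<close> is multiplication by
  \<open>(1 + x u\<^bsub>n-1\<^esub>) \<cdots> (1 + x u\<^sub>i)\<close> in the nilCoxeter algebra.\<close>

definition nil_row :: "nat \<Rightarrow> nat \<Rightarrow> zpoly \<Rightarrow> ((nat \<Rightarrow> nat) \<Rightarrow> zpoly) \<Rightarrow> (nat \<Rightarrow> nat) \<Rightarrow> zpoly" where
  "nil_row n i x f = foldr (\<lambda>a. nil_factor a x) [i..<n] f"

lemma nil_row_Suc: "i < n \<Longrightarrow> nil_row n i x f = nil_factor i x (nil_row n (Suc i) x f)"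
  by (simp add: nil_row_def upt_conv_Cons)

lemma nil_row_ge: "n \<le> i \<Longrightarrow> nil_row n i x f = f"
  by (simp add: nil_row_def)

lemma nil_row_linear:
  "nil_row n i x (\<lambda>w. f w - g w) = (\<lambda>w. nil_row n i x f w - nil_row n i x g w)"
  "nil_row n i x (\<lambda>w. c * f w) = (\<lambda>w. c * nil_row n i x f w)"
proof -
  have "foldr (\<lambda>a. nil_factor a x) as (\<lambda>w. f w - g w) =
        (\<lambda>w. foldr (\<lambda>a. nil_factor a x) as f w - foldr (\<lambda>a. nil_factor a x) as g w) \<and>
      foldr (\<lambda>a. nil_factor a x) as (\<lambda>w. c * f w) = (\<lambda>w. c * foldr (\<lambda>a. nil_factor a x) as f w)"
    for as
    by (induction as) (auto simp: nil_factor_linear)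
  then show "nil_row n i x (\<lambda>w. f w - g w) = (\<lambda>w. nil_row n i x f w - nil_row n i x g w)"
    "nil_row n i x (\<lambda>w. c * f w) = (\<lambda>w. c * nil_row n i x f w)"
    unfolding nil_row_def by blast+
qed

lemma nil_factor_row_comm:
  assumes "Suc i < j"
  shows "nil_factor i x (nil_row n j y f) = nil_row n j y (nil_factor i x f)"
proof -
  have "nil_factor i x (foldr (\<lambda>a. nil_factor a y) as f) = foldr (\<lambda>a. nil_factor a y) as (nil_factor i x f)"
    if "\<forall>a\<in>set as. Suc i < a" for as
    using that by (induction as) (auto simp: nil_factor_comm)
  then show ?thesis unfolding nil_row_def using assms by auto
qed

lemma nil_act_row_comm:
  assumes "Suc i < j"
  shows "nil_act i (nil_row n j y f) = nil_row n j y (nil_act i f)"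
proof -
  have *: "nil_act i (nil_factor a y f) = nil_factor a y (nil_act i f)" if "Suc i < a" for a f
    by (auto simp: nil_factor_alt nil_act_linear nil_act_comm[OF that])
  have "nil_act i (foldr (\<lambda>a. nil_factor a y) as f) = foldr (\<lambda>a. nil_factor a y) as (nil_act i f)"
    if "\<forall>a\<in>set as. Suc i < a" for as
    using that by (induction as) (auto simp: *)
  then show ?thesis unfolding nil_row_def using assms by auto
qed

lemma nil_row_factor_inverse:
  "i < n \<Longrightarrow> nil_factor i (- x) (nil_row n i x f) = nil_row n (Suc i) x f"
  by (simp add: nil_row_Suc nil_factor_add nil_factor_0)

text \<open>The symmetry behind the whole Schubert computation. Downward induction on
  \<open>i\<close>: both rows are reduced to start at \<open>Suc i\<close>, and the few factors left
  over are rearranged by Yang-Baxter.\<close>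

lemma nil_row_comm: "nil_row n i y (nil_row n i x f) = nil_row n i x (nil_row n i y f)"
proof (induction "n - i" arbitrary: i x y f)
  case (Suc k)
  then have "i < n" by simp
  note step = \<open>i < n\<close>
  show ?case
  proof (cases "Suc i < n")
    case False
    then show ?thesis using step by (simp add: nil_row_Suc nil_row_ge nil_factor_add add.commute)
  next
    case True
    have IH': "nil_row n (Suc i) y (nil_row n (Suc i) x f) = nil_row n (Suc i) x (nil_row n (Suc i) y f)"
      using Suc.hyps(1)[of "Suc i"] Suc.hyps(2) by simp
    \<comment> \<open>Moving the factor \<open>i\<close> of the \<open>x\<close> row past the tail
      of the \<open>y\<close> row leaves a \<open>y\<close> row that starts at
      \<open>Suc (Suc i)\<close>. Writing it as the row from \<open>Suc i\<close> with its last
      factor cancelled by \<open>- y\<close> brings in the pair to which the induction hypothesis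
      applies.\<close>
    have expand: "nil_row n i y (nil_row n i x f) =
        nil_factor i y (nil_factor (Suc i) y (nil_factor i x (nil_factor (Suc i) (- y)
          (nil_row n (Suc i) y (nil_row n (Suc i) x f)))))" for x y
    proof -
      have "nil_row n i y (nil_row n i x f) =
        nil_factor i y (nil_factor (Suc i) y (nil_row n (Suc (Suc i)) y (nil_factor i x (nil_row n (Suc i) x f))))"
        using True by (simp add: nil_row_Suc)
      also have "\<dots> = nil_factor i y (nil_factor (Suc i) y (nil_factor i x (nil_row n (Suc (Suc i)) y (nil_row n (Suc i) x f))))"
        by (simp add: nil_factor_row_comm)
      finally show ?thesis
        using True by (simp add: nil_row_factor_inverse)
    qed
    \<comment> \<open>The factor with \<open>y\<close> is split as \<open>x + (y - x)\<close>, so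
      that the three inner factors have the Yang-Baxter parameters \<open>y - x\<close>,
      \<open>y\<close>, \<open>x\<close>.\<close>
    have braid: "nil_factor i y (nil_factor (Suc i) y (nil_factor i x (nil_factor (Suc i) (- y) g))) =
        nil_factor i x (nil_factor (Suc i) x (nil_factor i y (nil_factor (Suc i) (- x) g)))" for g
    proof -
      have "nil_factor i y (nil_factor (Suc i) y (nil_factor i x (nil_factor (Suc i) (- y) g))) =
        nil_factor i x (nil_factor i (y - x) (nil_factor (Suc i) ((y - x) + x) (nil_factor i x (nil_factor (Suc i) (- y) g))))"
        by (simp add: nil_factor_add)
      also have "\<dots> = nil_factor i x (nil_factor (Suc i) x (nil_factor i y (nil_factor (Suc i) (y - x) (nil_factor (Suc i) (- y) g))))"
        by (subst nil_factor_yang_baxter) simp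
      finally show ?thesis by (simp add: nil_factor_add)
    qed
    show ?thesis
      by (simp only: expand IH' braid[of "nil_row n (Suc i) x (nil_row n (Suc i) y f)"])
  qed
qed (simp add: nil_row_ge)

section \<open>Divided differences\<close>

lemma zpoly_induct [case_names zero single_add]:
  assumes "P 0" "\<And>e c p. P p \<Longrightarrow> P (Poly_Mapping.single e c + p)"
  shows "P (p :: 'a \<Rightarrow>\<^sub>0 int)"
proof (induction p rule: update_induct)
  case (update p a b)
  then have "Poly_Mapping.update a b p = Poly_Mapping.single a b + p"
    by (intro poly_mapping_eqI) (auto simp: lookup_update lookup_add lookup_single in_keys_iff)
  then show ?case using assms update by simp
qed (use assms in simp)

text \<open>The laws of \<open>map_key\<close> assume an injective key map; this one is an
  involution.\<close>

lemma swap_exponent_inj: "inj (Poly_Mapping.map_key (transpose i (Suc i)) :: (nat \<Rightarrow>\<^sub>0 nat) \<Rightarrow> _)"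
proof (rule injI)
  fix p q :: "nat \<Rightarrow>\<^sub>0 nat"
  assume "Poly_Mapping.map_key (transpose i (Suc i)) p = Poly_Mapping.map_key (transpose i (Suc i)) q"
  then have "Poly_Mapping.map_key (transpose i (Suc i)) (Poly_Mapping.map_key (transpose i (Suc i)) p) =
      Poly_Mapping.map_key (transpose i (Suc i)) (Poly_Mapping.map_key (transpose i (Suc i)) q)" by simp
  then show "p = q" by (simp add: map_key_compose map_key_id[folded id_def])
qed

lemma swap_vars_add: "swap_vars i (p + q) = swap_vars i p + swap_vars i q"
  unfolding swap_vars_def by (rule map_key_plus[OF swap_exponent_inj])

lemma swap_vars_0 [simp]: "swap_vars i 0 = 0"
  unfolding swap_vars_def by (rule map_key_zero[OF swap_exponent_inj])

lemma swap_vars_single: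
  "swap_vars i (Poly_Mapping.single e c) =
   Poly_Mapping.single (Poly_Mapping.map_key (transpose i (Suc i)) e) c"
proof -
  have "e = Poly_Mapping.map_key (transpose i (Suc i)) (Poly_Mapping.map_key (transpose i (Suc i)) e)"
    by (simp add: map_key_compose map_key_id[folded id_def])
  then show ?thesis unfolding swap_vars_def by (metis map_key_single[OF swap_exponent_inj])
qed

lemma swap_vars_mult: "swap_vars i (p * q) = swap_vars i p * swap_vars i q"
proof (induction p rule: zpoly_induct)
  case (single_add e c p)
  have "swap_vars i (Poly_Mapping.single e c * q) = swap_vars i (Poly_Mapping.single e c) * swap_vars i q"
    by (induction q rule: zpoly_induct)
       (simp_all add: swap_vars_add swap_vars_single mult_single distrib_left map_key_plus)
  with single_add show ?case by (simp add: swap_vars_add distrib_right)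
qed simp

lemma swap_vars_1 [simp]: "swap_vars i 1 = 1"
  by (simp flip: single_one add: swap_vars_single)

lemma swap_vars_x_var: "swap_vars i (x_var j) = x_var (transpose i (Suc i) j)"
proof -
  have "Poly_Mapping.map_key (transpose i (Suc i)) (Poly_Mapping.single j 1) =
      Poly_Mapping.single (transpose i (Suc i) j) (1::nat)"
    using map_key_single[of "transpose i (Suc i)" "transpose i (Suc i) j" "1::nat"] by simp
  then show ?thesis by (simp add: x_var_def swap_vars_single)
qed

lemma x_var_eq_iff: "x_var i = x_var j \<longleftrightarrow> i = j"
proof
  assume "x_var i = x_var j"
  then have "Poly_Mapping.keys (x_var i) = Poly_Mapping.keys (x_var j)" by simp
  then have "Poly_Mapping.single i (1::nat) = Poly_Mapping.single j 1" by (simp add: x_var_def)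
  then have "Poly_Mapping.keys (Poly_Mapping.single i (1::nat)) = Poly_Mapping.keys (Poly_Mapping.single j (1::nat))" by simp
  then show "i = j" by simp
qed simp

lemma divided_difference_eqI:
  assumes "f - swap_vars i f = (x_var i - x_var (Suc i)) * g"
  shows "divided_difference i f = g"
  unfolding divided_difference_def
proof (rule the_equality)
  fix h assume "(x_var i - x_var (Suc i)) * h = f - swap_vars i f"
  moreover have "x_var i - x_var (Suc i) \<noteq> 0" by (simp add: x_var_eq_iff)
  ultimately show "h = g" using assms by (metis mult_left_cancel)
qed (use assms in simp)

section \<open>The Fomin-Stanley element and its divided differences\<close>

definition nil_unit :: "(nat \<Rightarrow> nat) \<Rightarrow> zpoly" where
  "nil_unit w = (if w = id then 1 else 0)"

text \<open>With A_r(x) for \<open>nil_row n r x\<close>, this is A_1(x_1) A_2(x_2) ... A_n(x_n),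
  and the value at \<open>w\<close> is the coefficient of u_w. The trivial factor
  \<open>r = n\<close> is kept so that rows \<open>i\<close> and \<open>Suc i\<close> both occur for
  every \<open>i < n\<close>.\<close>

definition schubert_gen :: "nat \<Rightarrow> (nat \<Rightarrow> nat) \<Rightarrow> zpoly" where
  "schubert_gen n = fold (\<lambda>r. nil_row n r (x_var r)) [1..<Suc n] nil_unit"

lemma swap_nil_row:
  "swap_vars i \<circ> nil_row n r x f = nil_row n r (swap_vars i x) (swap_vars i \<circ> f)"
proof -
  have *: "swap_vars i \<circ> nil_factor a x f = nil_factor a (swap_vars i x) (swap_vars i \<circ> f)" for a f
    by (auto simp: nil_factor_def nil_act_def swap_vars_add swap_vars_mult fun_eq_iff)
  have "swap_vars i \<circ> foldr (\<lambda>a. nil_factor a x) as f =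
      foldr (\<lambda>a. nil_factor a (swap_vars i x)) as (swap_vars i \<circ> f)" for as
    by (induction as) (simp, simp only: foldr_Cons o_apply[of "nil_factor _ _"] *)
  then show ?thesis by (simp add: nil_row_def)
qed

lemma swap_fold_nil_row:
  assumes "\<forall>r\<in>set rs. r \<noteq> i \<and> r \<noteq> Suc i"
  shows "swap_vars i \<circ> fold (\<lambda>r. nil_row n r (x_var r)) rs f =
    fold (\<lambda>r. nil_row n r (x_var r)) rs (swap_vars i \<circ> f)"
  using assms by (induction rs arbitrary: f) (auto simp: swap_nil_row swap_vars_x_var)

lemma fold_nil_row_linear:
  "fold (\<lambda>r. nil_row n r (x_var r)) rs (\<lambda>w. f w - g w) =
   (\<lambda>w. fold (\<lambda>r. nil_row n r (x_var r)) rs f w - fold (\<lambda>r. nil_row n r (x_var r)) rs g w)"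
  "fold (\<lambda>r. nil_row n r (x_var r)) rs (\<lambda>w. c * f w) =
   (\<lambda>w. c * fold (\<lambda>r. nil_row n r (x_var r)) rs f w)"
  by (induction rs arbitrary: f g) (auto simp: nil_row_linear)

lemma fold_nil_row_act_comm:
  assumes "\<forall>r\<in>set rs. Suc i < r"
  shows "nil_act i (fold (\<lambda>r. nil_row n r (x_var r)) rs f) =
    fold (\<lambda>r. nil_row n r (x_var r)) rs (nil_act i f)"
  using assms by (induction rs arbitrary: f) (auto simp: nil_act_row_comm)

text \<open>\<open>A\<^sub>i(x) A\<^sub>i\<^sub>+\<^sub>1(y) (1 + y u\<^sub>i) = A\<^sub>i(x) A\<^sub>i(y)\<close> is symmetric in \<open>x\<close> and \<open>y\<close>.\<close>

lemma nil_row_pair_difference: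
  fixes g
  assumes "i < n"
  defines "F \<equiv> \<lambda>x y. nil_row n (Suc i) y (nil_row n i x g)"
  shows "F x y w - F y x w = (x - y) * nil_act i (F x y) w"
proof -
  have sym: "nil_factor i y (F x y) = nil_factor i x (F y x)"
    using nil_row_comm[of n i y x g] assms by (simp add: nil_row_Suc)
  \<comment> \<open>As u_i squared is 0, multiplying by u_i removes the extra factors from
    \<open>sym\<close>.\<close>
  have "nil_act i (nil_factor i y (F x y)) = nil_act i (nil_factor i x (F y x))"
    by (simp add: sym)
  then have act: "nil_act i (F x y) = nil_act i (F y x)"
    by (simp add: nil_factor_alt nil_act_linear nil_act_square)
  have "F x y w + y * nil_act i (F x y) w = F y x w + x * nil_act i (F x y) w"
    using fun_cong[OF sym, of w] by (simp add: nil_factor_def act)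
  then show ?thesis by (simp add: algebra_simps)
qed

text \<open>Only rows \<open>i\<close> and \<open>Suc i\<close> contain the two variables. The rows
  before them are fixed by the swap, and the rows after them use generators beyond
  \<open>Suc i\<close>, which commute with u_i, so the identity for the pair of rows passes
  through.\<close>

lemma schubert_gen_difference:
  assumes "1 \<le> i" "i < n"
  shows "schubert_gen n w - swap_vars i (schubert_gen n w) =
    (x_var i - x_var (Suc i)) * nil_act i (schubert_gen n) w"
proof -
  define R where "R = (\<lambda>rs. fold (\<lambda>r. nil_row n r (x_var r)) rs)"
  define g where "g = R [1..<i] nil_unit"
  define F where "F = (\<lambda>x y. nil_row n (Suc i) y (nil_row n i x g))"
  let ?x = "x_var i" and ?y = "x_var (Suc i)"
  let ?T = "[Suc (Suc i)..<Suc n]"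
  have "[1..<Suc n] = [1..<i] @ [i..<Suc n]"
    using assms upt_add_eq_append[of 1 i "Suc n - i"] by simp
  also have "[i..<Suc n] = i # Suc i # ?T"
    using assms by (simp add: upt_conv_Cons)
  finally have "[1..<Suc n] = [1..<i] @ i # Suc i # ?T" .
  then have S: "schubert_gen n = R ?T (F ?x ?y)"
    by (simp add: schubert_gen_def R_def F_def g_def)
  have "swap_vars i \<circ> nil_unit = nil_unit" by (auto simp: nil_unit_def fun_eq_iff)
  then have "swap_vars i \<circ> g = g"
    unfolding g_def R_def by (subst swap_fold_nil_row) auto
  then have "swap_vars i \<circ> F ?x ?y = F ?y ?x"
    unfolding F_def by (simp add: swap_nil_row swap_vars_x_var)
  then have S': "swap_vars i \<circ> schubert_gen n = R ?T (F ?y ?x)"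
    unfolding S unfolding R_def by (subst swap_fold_nil_row) auto
  have "(\<lambda>w. F ?x ?y w - F ?y ?x w) = (\<lambda>w. (?x - ?y) * nil_act i (F ?x ?y) w)"
    unfolding F_def using nil_row_pair_difference[OF assms(2), of ?y ?x] by (intro ext) simp
  then have "R ?T (\<lambda>w. F ?x ?y w - F ?y ?x w) = R ?T (\<lambda>w. (?x - ?y) * nil_act i (F ?x ?y) w)"
    by simp
  also have "\<dots> = (\<lambda>w. (?x - ?y) * R ?T (nil_act i (F ?x ?y)) w)"
    unfolding R_def by (rule fold_nil_row_linear)
  also have "R ?T (nil_act i (F ?x ?y)) = nil_act i (schubert_gen n)"
    unfolding S unfolding R_def by (subst fold_nil_row_act_comm) auto
  also have "R ?T (\<lambda>w. F ?x ?y w - F ?y ?x w) = (\<lambda>w. R ?T (F ?x ?y) w - R ?T (F ?y ?x) w)"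
    unfolding R_def by (rule fold_nil_row_linear)
  finally have "(\<lambda>w. schubert_gen n w - swap_vars i (schubert_gen n w)) =
    (\<lambda>w. (?x - ?y) * nil_act i (schubert_gen n) w)"
    unfolding S[symmetric] S'[symmetric] by simp
  then show ?thesis by metis
qed

lemma divided_difference_schubert_gen:
  assumes "1 \<le> i" "i < n" "w (Suc i) < w i"
  shows "divided_difference i (schubert_gen n w) = schubert_gen n (w \<circ> transpose i (Suc i))"
  using schubert_gen_difference[OF assms(1,2), of w] assms(3)
  by (intro divided_difference_eqI) (simp add: nil_act_def)

section \<open>Length and Demazure products\<close>

declare One_nat_def [simp del]

abbreviation adj :: "nat \<Rightarrow> nat \<Rightarrow> nat" where
  "adj a \<equiv> transpose a (Suc a)"

text \<open>The notation \<open>inv\<close> belongs to HOL-Algebra here.\<close>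

abbreviation pinv :: "(nat \<Rightarrow> nat) \<Rightarrow> nat \<Rightarrow> nat" where
  "pinv \<equiv> Hilbert_Choice.inv"

lemma adj_permutes: "1 \<le> a \<Longrightarrow> a < n \<Longrightarrow> adj a permutes {1..n}"
  by (rule permutes_swap_id) auto

lemma adj_comp_adj [simp]: "w \<circ> adj a \<circ> adj a = w" "adj a \<circ> (adj a \<circ> w) = w"
  by (rule ext, simp)+

text \<open>Exchanging the two positions in every pair maps the inversions of \<open>w\<close> onto
  those of \<open>w \<circ> adj i\<close> other than the new one \<open>(i, Suc i)\<close>.\<close>

lemma inv_length_adj_ascent:
  assumes "w permutes {1..n}" "1 \<le> i" "i < n" "w i < w (Suc i)"
  shows "inv_length n (w \<circ> adj i) = Suc (inv_length n w)"
proof -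
  define I where "I = (\<lambda>w. {(i, j). 1 \<le> i \<and> i < j \<and> j \<le> n \<and> (w j :: nat) < w i})"
  have fin: "finite (I w)" for w
    by (rule finite_subset[of _ "{1..n} \<times> {1..n}"]) (auto simp: I_def)
  have less: "adj i a < adj i b \<longleftrightarrow> a < b"
    if "\<not> (a = i \<and> b = Suc i)" "\<not> (a = Suc i \<and> b = i)" for a b
    using that by (auto simp: transpose_def)
  have range: "1 \<le> adj i a \<and> adj i a \<le> n \<longleftrightarrow> 1 \<le> a \<and> a \<le> n" for a
    using assms(2,3) by (auto simp: transpose_def)
  have mem: "(a, b) \<in> I w \<longleftrightarrow> (1 \<le> a \<and> a \<le> n) \<and> (1 \<le> b \<and> b \<le> n) \<and> a < b \<and> w b < w a" for a b w
    by (auto simp: I_def)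
  have iff: "(a, b) \<in> I (w \<circ> adj i) \<longleftrightarrow> a = i \<and> b = Suc i \<or> (adj i a, adj i b) \<in> I w" for a b
  proof -
    consider "a = i \<and> b = Suc i" | "a = Suc i \<and> b = i"
      | "\<not> (a = i \<and> b = Suc i)" "\<not> (a = Suc i \<and> b = i)" by blast
    then show ?thesis
    proof cases
      case 3
      then show ?thesis by (simp only: mem range o_apply less[OF 3]) auto
    qed (use assms in \<open>simp_all add: mem\<close>)
  qed
  have img: "x \<in> map_prod (adj i) (adj i) ` I w \<longleftrightarrow> (adj i (fst x), adj i (snd x)) \<in> I w" for x
    by (cases x) (force simp: image_iff)
  have eq: "I (w \<circ> adj i) = insert (i, Suc i) (map_prod (adj i) (adj i) ` I w)" (is "?L = ?R")
  proof (rule Set.set_eqI)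
    fix x
    show "x \<in> ?L \<longleftrightarrow> x \<in> ?R"
      by (cases x) (simp only: insert_iff img iff prod.inject fst_conv snd_conv)
  qed
  have "(i, Suc i) \<notin> map_prod (adj i) (adj i) ` I w"
    by (simp add: img mem)
  moreover have "card (map_prod (adj i) (adj i) ` I w) = card (I w)"
    by (intro card_image inj_on_subset[OF prod.inj_map[OF inj_transpose inj_transpose]]) simp
  ultimately have "card (I (w \<circ> adj i)) = Suc (card (I w))"
    using eq fin[of w] by simp
  then show ?thesis by (simp add: inv_length_def I_def)
qed

lemma permutes_adj_neq:
  assumes "w permutes {1..n}"
  shows "w i \<noteq> w (Suc i)"
  by (simp add: inj_eq[OF permutes_inj[OF assms]])

lemma permutes_comp_adj:
  "w permutes {1..n} \<Longrightarrow> 1 \<le> i \<Longrightarrow> i < n \<Longrightarrow> w \<circ> adj i permutes {1..n}"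
  "w permutes {1..n} \<Longrightarrow> 1 \<le> i \<Longrightarrow> i < n \<Longrightarrow> adj i \<circ> w permutes {1..n}"
  by (rule permutes_compose[OF adj_permutes], assumption+)
     (rule permutes_compose[OF _ adj_permutes], assumption+)

lemma inv_length_adj_descent:
  assumes "w permutes {1..n}" "1 \<le> i" "i < n" "w (Suc i) < w i"
  shows "inv_length n w = Suc (inv_length n (w \<circ> adj i))"
  using inv_length_adj_ascent[OF permutes_comp_adj(1)[OF assms(1-3)] assms(2,3)] assms(4) by simp

text \<open>Sending an inversion \<open>(i, j)\<close> to \<open>(w j, w i)\<close> is injective;
  applying this to \<open>w\<close> and to its inverse gives both inequalities.\<close>

lemma inv_length_inv:
  assumes "w permutes {1..n}"
  shows "inv_length n (pinv w) = inv_length n w"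
proof -
  have le: "inv_length n w \<le> inv_length n (pinv w)" if w: "w permutes {1..n}" for w
    unfolding inv_length_def
  proof (rule card_inj_on_le)
    let ?f = "\<lambda>(i, j). (w j, w i)"
    show "inj_on ?f {(i, j). 1 \<le> i \<and> i < j \<and> j \<le> n \<and> w j < w i}"
      by (auto simp: inj_on_def inj_eq[OF permutes_inj[OF w]])
    show "?f ` {(i, j). 1 \<le> i \<and> i < j \<and> j \<le> n \<and> w j < w i} \<subseteq>
        {(i, j). 1 \<le> i \<and> i < j \<and> j \<le> n \<and> pinv w j < pinv w i}"
    proof clarify
      fix i j assume ij: "1 \<le> i" "i < j" "j \<le> n" "w j < w i"
      then have "w j \<in> {1..n}" "w i \<in> {1..n}" by (simp_all only: permutes_in_image[OF w]) simp_all
      then show "1 \<le> w j \<and> w j < w i \<and> w i \<le> n \<and> pinv w (w i) < pinv w (w j)"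
        using ij by (simp add: permutes_inverses(2)[OF w])
    qed
    show "finite {(i, j). 1 \<le> i \<and> i < j \<and> j \<le> n \<and> pinv w j < pinv w i}"
      by (rule finite_subset[of _ "{1..n} \<times> {1..n}"]) auto
  qed
  show ?thesis
    using le[OF assms] le[OF permutes_inv[OF assms]] permutes_inv_inv[OF assms] by simp
qed

lemma inv_adj_comp:
  assumes "w permutes {1..n}"
  shows "pinv (adj a \<circ> w) = pinv w \<circ> adj a"
  using o_inv_distrib[OF bij_transpose permutes_bij[OF assms]] by simp

lemma inv_length_left_ascent:
  assumes "w permutes {1..n}" "1 \<le> i" "i < n" "pinv w i < pinv w (Suc i)"
  shows "inv_length n (adj i \<circ> w) = Suc (inv_length n w)"
proof -
  have "inv_length n (adj i \<circ> w) = inv_length n (pinv w \<circ> adj i)"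
    using inv_length_inv[OF permutes_comp_adj(2)[OF assms(1-3)]]
    unfolding inv_adj_comp[OF assms(1)] by simp
  then show ?thesis
    using inv_length_adj_ascent[of "pinv w" n i] assms by (simp add: permutes_inv inv_length_inv)
qed

lemma inv_length_left_descent:
  assumes "w permutes {1..n}" "1 \<le> i" "i < n" "pinv w (Suc i) < pinv w i"
  shows "inv_length n w = Suc (inv_length n (adj i \<circ> w))"
proof -
  have "inv_length n (adj i \<circ> w) = inv_length n (pinv w \<circ> adj i)"
    using inv_length_inv[OF permutes_comp_adj(2)[OF assms(1-3)]]
    unfolding inv_adj_comp[OF assms(1)] by simp
  then show ?thesis
    using inv_length_adj_descent[of "pinv w" n i] assms by (simp add: permutes_inv inv_length_inv)
qed

lemma no_descent_imp_id:
  assumes w: "w permutes {1..n}" and no: "\<And>i. 1 \<le> i \<Longrightarrow> i < n \<Longrightarrow> \<not> w (Suc i) < w i"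
  shows "w = id"
proof -
  have step: "w i < w (Suc i)" if "1 \<le> i" "i < n" for i
    using no[OF that] permutes_adj_neq[OF w, of i] by linarith
  have lower: "k \<le> w k" if "k \<le> n" for k
    using that
  proof (induction k)
    case (Suc k)
    then show ?case
    proof (cases "k = 0")
      case True
      then show ?thesis using permutes_in_image[OF w, of 1] Suc by (auto simp: One_nat_def)
    next
      case False
      then show ?thesis using Suc step[of k] by simp
    qed
  qed simp
  have upper: "w (n - k) \<le> n - k" if "k < n" for k
    using that
  proof (induction k)
    case 0
    then show ?case using permutes_in_image[OF w, of n] by auto
  next
    case (Suc k)
    then have "Suc (n - Suc k) = n - k" "1 \<le> n - Suc k" by simp_all
    then show ?case using Suc step[of "n - Suc k"] by simp
  qed
  have "w i = i" for i
  proof (cases "i \<in> {1..n}")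
    case True
    then show ?thesis using lower[of i] upper[of "n - i"] by simp
  next
    case False
    then show ?thesis using w by (simp add: permutes_def)
  qed
  then show ?thesis by auto
qed

lemma inv_length_id [simp]: "inv_length n id = 0"
proof -
  have "{(i, j). 1 \<le> i \<and> i < j \<and> j \<le> n \<and> id j < (id i :: nat)} = {}" by auto
  then show ?thesis unfolding inv_length_def by (metis card.empty)
qed

lemma descent_induct [consumes 1, case_names id descent]:
  assumes "w permutes {1..n}" and "P id"
    and "\<And>w i. w permutes {1..n} \<Longrightarrow> 1 \<le> i \<Longrightarrow> i < n \<Longrightarrow> w (Suc i) < w i \<Longrightarrow> P (w \<circ> adj i) \<Longrightarrow> P w"
  shows "P w"
  using assms(1)
proof (induction "inv_length n w" arbitrary: w rule: less_induct)
  case less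
  show ?case
  proof (cases "w = id")
    case False
    then obtain i where i: "1 \<le> i" "i < n" "w (Suc i) < w i"
      using no_descent_imp_id[OF less.prems] by blast
    then show ?thesis
      using less.prems less.hyps[of "w \<circ> adj i"] inv_length_adj_descent[OF less.prems i]
      by (intro assms(3)[of w i]) (auto simp: permutes_comp_adj)
  qed (use assms in simp)
qed

section \<open>Words, ordinary products and Demazure products\<close>

definition word_perm :: "nat list \<Rightarrow> nat \<Rightarrow> nat" where
  "word_perm as = foldr (\<lambda>a w. adj a \<circ> w) as id"

text \<open>Left multiplication in the 0-Hecke monoid: the letter acts only if value
  \<open>a\<close> stands before value \<open>Suc a\<close>, that is, if it lengthens
  \<open>w\<close>. Acting on values lets the set w{1..d} be followed letter by letter.\<close>

definition demazure_step :: "nat \<Rightarrow> (nat \<Rightarrow> nat) \<Rightarrow> nat \<Rightarrow> nat" where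
  "demazure_step a w = (if pinv w a < pinv w (Suc a) then adj a \<circ> w else w)"

definition demazure :: "nat list \<Rightarrow> nat \<Rightarrow> nat" where
  "demazure as = foldr demazure_step as id"

lemma word_perm_simps [simp]:
  "word_perm [] = id" "word_perm (a # as) = adj a \<circ> word_perm as"
  by (simp_all add: word_perm_def)

lemma word_perm_append: "word_perm (as @ bs) = word_perm as \<circ> word_perm bs"
  by (induction as) (auto simp: o_assoc)

lemma demazure_simps [simp]:
  "demazure [] = id" "demazure (a # as) = demazure_step a (demazure as)"
  by (simp_all add: demazure_def)

lemma word_perm_permutes: "set as \<subseteq> {1..<n} \<Longrightarrow> word_perm as permutes {1..n}"
  by (induction as) (simp_all add: permutes_comp_adj permutes_id)

lemma demazure_permutes: "set as \<subseteq> {1..<n} \<Longrightarrow> demazure as permutes {1..n}"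
  by (induction as) (simp_all add: permutes_comp_adj permutes_id demazure_step_def)

lemma inv_length_left_le:
  assumes "w permutes {1..n}" "1 \<le> i" "i < n"
  shows "inv_length n (adj i \<circ> w) \<le> Suc (inv_length n w)"
proof -
  have "pinv w i \<noteq> pinv w (Suc i)"
    using permutes_adj_neq[OF permutes_inv[OF assms(1)]] .
  then show ?thesis
    using inv_length_left_ascent[OF assms] inv_length_left_descent[OF assms] by linarith
qed

lemma inv_length_word_perm: "set as \<subseteq> {1..<n} \<Longrightarrow> inv_length n (word_perm as) \<le> length as"
proof (induction as)
  case (Cons a as)
  then have "inv_length n (adj a \<circ> word_perm as) \<le> Suc (inv_length n (word_perm as))"
    by (intro inv_length_left_le word_perm_permutes) simp_all
  also have "\<dots> \<le> length (a # as)" using Cons by simp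
  finally show ?case by (simp only: word_perm_simps)
qed simp

lemma inv_length_demazure: "set as \<subseteq> {1..<n} \<Longrightarrow> inv_length n (demazure as) \<le> length as"
proof (induction as)
  case (Cons a as)
  then have "inv_length n (demazure (a # as)) \<le> Suc (inv_length n (demazure as))"
    using inv_length_left_le[of "demazure as" n a] demazure_permutes[of as n]
    by (simp add: demazure_step_def)
  also have "\<dots> \<le> length (a # as)" using Cons by simp
  finally show ?case .
qed simp

text \<open>A letter raises the length by at most one in either product. A product as long as its
  word therefore gains one at every letter, and there the two products take the same step. This
  links the nilCoxeter expansion, which counts reduced words, with Demazure products.\<close>

lemma demazure_reduced_iff:
  assumes "set as \<subseteq> {1..<n}"
  shows "word_perm as = w \<and> inv_length n w = length as \<longleftrightarrow>
    demazure as = w \<and> inv_length n w = length as"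
proof -
  have "inv_length n (word_perm as) = length as \<Longrightarrow> demazure as = word_perm as"
    using assms
  proof (induction as)
    case (Cons a as)
    then have a: "1 \<le> a" "a < n" and as: "set as \<subseteq> {1..<n}" by simp_all
    note perm = word_perm_permutes[OF as] and le = inv_length_word_perm[OF as]
    have len: "inv_length n (adj a \<circ> word_perm as) = Suc (length as)"
      using Cons.prems(1) by (simp only: word_perm_simps list.size)
    have "pinv (word_perm as) a \<noteq> pinv (word_perm as) (Suc a)"
      by (rule permutes_adj_neq[OF permutes_inv[OF perm]])
    moreover have "\<not> pinv (word_perm as) (Suc a) < pinv (word_perm as) a"
      using inv_length_left_descent[OF perm a] le len by linarith
    ultimately have asc: "pinv (word_perm as) a < pinv (word_perm as) (Suc a)" by linarith
    then have "inv_length n (word_perm as) = length as"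
      using inv_length_left_ascent[OF perm a] len by linarith
    then show ?case using asc Cons.IH[OF _ as] by (simp add: demazure_step_def)
  qed simp
  moreover have "inv_length n (demazure as) = length as \<Longrightarrow> demazure as = word_perm as"
    using assms
  proof (induction as)
    case (Cons a as)
    then have a: "1 \<le> a" "a < n" and as: "set as \<subseteq> {1..<n}" by simp_all
    have le: "inv_length n (demazure as) \<le> length as" by (rule inv_length_demazure[OF as])
    have asc: "pinv (demazure as) a < pinv (demazure as) (Suc a)"
    proof (rule ccontr)
      assume "\<not> ?thesis"
      then have "demazure (a # as) = demazure as" by (simp add: demazure_step_def)
      then show False using Cons.prems(1) le by simp
    qed
    then have eq: "demazure (a # as) = adj a \<circ> demazure as" by (simp add: demazure_step_def)
    then have "inv_length n (demazure as) = length as"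
      using inv_length_left_ascent[OF demazure_permutes[OF as] a asc] Cons.prems(1)
      by (metis length_Cons nat.inject)
    then show ?case using eq Cons.IH[OF _ as] by simp
  qed simp
  ultimately show ?thesis by metis
qed

lemma nil_word_coeff:
  assumes "set as \<subseteq> {1..<n}" "w permutes {1..n}"
  shows "fold nil_act as nil_unit w =
    (if word_perm as = w \<and> inv_length n w = length as then 1 else 0)"
  using assms
proof (induction as arbitrary: w rule: rev_induct)
  case Nil
  then show ?case by (auto simp: nil_unit_def)
next
  case (snoc a as)
  then have a: "1 \<le> a" "a < n" and as: "set as \<subseteq> {1..<n}" by auto
  have eq: "word_perm (as @ [a]) = w \<longleftrightarrow> word_perm as = w \<circ> adj a"
    by (metis adj_comp_adj(1) comp_id word_perm_append word_perm_simps)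
  show ?case
  proof (cases "w (Suc a) < w a")
    case True
    then have "fold nil_act (as @ [a]) nil_unit w = fold nil_act as nil_unit (w \<circ> adj a)"
      by (simp add: nil_act_def[of a])
    also have "\<dots> = (if word_perm as = w \<circ> adj a \<and> inv_length n (w \<circ> adj a) = length as then 1 else 0)"
      by (rule snoc.IH[OF as permutes_comp_adj(1)[OF snoc.prems(2) a]])
    also have "inv_length n (w \<circ> adj a) = length as \<longleftrightarrow> inv_length n w = length (as @ [a])"
      using inv_length_adj_descent[OF snoc.prems(2) a True] by simp
    finally show ?thesis by (simp only: eq)
  next
    case False
    then have "w a < w (Suc a)" using permutes_adj_neq[OF snoc.prems(2), of a] by linarith
    then have "inv_length n (w \<circ> adj a) = Suc (inv_length n w)"
      using inv_length_adj_ascent[OF snoc.prems(2) a] by simp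
    \<comment> \<open>Otherwise \<open>w \<circ> adj a\<close> would be a product of
      \<open>length as\<close> letters although its length is two more than that.\<close>
    then have "\<not> (word_perm as = w \<circ> adj a \<and> inv_length n w = Suc (length as))"
      using inv_length_word_perm[OF as] by auto
    then show ?thesis using False eq by (auto simp: nil_act_def)
  qed
qed

section \<open>Pipe dreams and Schubert polynomials\<close>

text \<open>A cross in row \<open>r\<close> and column \<open>c\<close> of a pipe dream is recorded as \<open>(r, a)\<close> with
  \<open>a = r + c - 1\<close> the index of the simple transposition it contributes. Rows are read from
  right to left, from the top row downwards.\<close>

definition staircase :: "nat \<Rightarrow> (nat \<times> nat) set" where
  "staircase n = {(r, a). 1 \<le> r \<and> r \<le> a \<and> a < n}"

definition reading :: "nat \<Rightarrow> (nat \<times> nat) list" where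
  "reading n = concat (map (\<lambda>r. map (Pair r) (rev [r..<n])) [1..<Suc n])"

definition reading_word :: "nat \<Rightarrow> (nat \<times> nat) set \<Rightarrow> nat list" where
  "reading_word n P = map snd (filter (\<lambda>p. p \<in> P) (reading n))"

definition crosses_weight :: "(nat \<times> nat) set \<Rightarrow> zpoly" where
  "crosses_weight P = (\<Prod>p\<in>P. x_var (fst p))"

text \<open>The two conditions together say that the reading word is reduced with product
  \<open>w\<close>. Stating this through the Demazure product makes it comparable with the criterion
  for arbitrary cross sets.\<close>

definition pipe_dreams :: "nat \<Rightarrow> (nat \<Rightarrow> nat) \<Rightarrow> (nat \<times> nat) set set" where
  "pipe_dreams n w = {P. P \<subseteq> staircase n \<and> demazure (reading_word n P) = w \<and> inv_length n w = card P}"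

lemma set_reading: "set (reading n) = staircase n"
  by (auto simp: reading_def staircase_def)

lemma distinct_reading: "distinct (reading n)"
  unfolding reading_def
proof (rule distinct_concat)
  have "inj_on (\<lambda>r. map (Pair r) (rev [r..<n])) {1..<Suc n}"
  proof (rule inj_onI)
    fix x y assume xy: "x \<in> {1..<Suc n}" "y \<in> {1..<Suc n}"
      and eq: "map (Pair x) (rev [x..<n]) = map (Pair y) (rev [y..<n])"
    show "x = y"
    proof (cases "x < n \<and> y < n")
      case True
      then show ?thesis using arg_cong[OF eq, of "\<lambda>ps. fst (hd ps)"] by (simp add: hd_map)
    next
      case False
      then show ?thesis using arg_cong[OF eq, of length] xy by simp linarith
    qed
  qed
  then show "distinct (map (\<lambda>r. map (Pair r) (rev [r..<n])) [1..<Suc n])"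
    by (simp only: distinct_map distinct_upt set_upt)
qed (auto simp: distinct_map inj_on_def)

lemma finite_staircase: "finite (staircase n)"
  by (metis List.finite_set set_reading)

lemma set_reading_word: "set (reading_word n P) \<subseteq> {1..<n}"
  unfolding reading_word_def set_map set_filter set_reading by (force simp: staircase_def)

lemma length_reading_word:
  assumes "P \<subseteq> staircase n"
  shows "length (reading_word n P) = card P"
proof -
  have "length (filter (\<lambda>p. p \<in> P) (reading n)) = card (set (filter (\<lambda>p. p \<in> P) (reading n)))"
    by (rule distinct_card[symmetric]) (simp add: distinct_reading)
  also have "set (filter (\<lambda>p. p \<in> P) (reading n)) = P"
    using assms unfolding set_filter set_reading by blast
  finally show ?thesis by (simp only: reading_word_def length_map)
qed

lemma schubert_gen_reading:
  "schubert_gen n = fold (\<lambda>p. nil_factor (snd p) (x_var (fst p))) (reading n) nil_unit"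
proof -
  have row: "nil_row n r x f = fold (\<lambda>p. nil_factor (snd p) x) (map (Pair r) (rev [r..<n])) f" for r x f
    by (simp add: nil_row_def foldr_conv_fold fold_map o_def)
  have row': "nil_row n r (x_var r) f =
      fold (\<lambda>p. nil_factor (snd p) (x_var (fst p))) (map (Pair r) (rev [r..<n])) f" for r f
    unfolding row by (rule fold_cong) auto
  have "fold (\<lambda>r. nil_row n r (x_var r)) rs f =
      fold (\<lambda>p. nil_factor (snd p) (x_var (fst p))) (concat (map (\<lambda>r. map (Pair r) (rev [r..<n])) rs)) f" for rs f
    by (induction rs arbitrary: f) (simp_all add: row')
  then show ?thesis by (simp add: schubert_gen_def reading_def)
qed

text \<open>Multiplying out the factors 1 + x u: \<open>P\<close> records from which factors the
  term x u is taken.\<close>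

lemma nil_factor_fold_expand:
  assumes "distinct ps"
  shows "fold (\<lambda>p. nil_factor (snd p) (x_var (fst p))) ps nil_unit w =
    (\<Sum>P\<in>Pow (set ps). crosses_weight P * fold nil_act (map snd (filter (\<lambda>p. p \<in> P) ps)) nil_unit w)"
  using assms
proof (induction ps arbitrary: w rule: rev_induct)
  case Nil
  then show ?case by (simp add: crosses_weight_def)
next
  case (snoc p ps)
  define c where "c = (\<lambda>(ps :: (nat \<times> nat) list) P w. fold nil_act (map snd (filter (\<lambda>p. p \<in> P) ps)) nil_unit w)"
  have IH: "fold (\<lambda>p. nil_factor (snd p) (x_var (fst p))) ps nil_unit =
      (\<lambda>w. \<Sum>P\<in>Pow (set ps). crosses_weight P * c ps P w)"
    using snoc by (auto simp: c_def)
  have p: "p \<notin> set ps" using snoc.prems by auto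
  have out: "c (ps @ [p]) P w = c ps P w" if "P \<in> Pow (set ps)" for P
    using that p by (auto simp: c_def)
  have "filter (\<lambda>q. q \<in> insert p P) ps = filter (\<lambda>q. q \<in> P) ps" for P
    using p by (auto intro: filter_cong)
  then have inn: "c (ps @ [p]) (insert p P) w = nil_act (snd p) (c ps P) w" for P
    by (simp add: c_def)
  have wt: "crosses_weight (insert p P) = x_var (fst p) * crosses_weight P" if "P \<in> Pow (set ps)" for P
  proof -
    have "finite P" "p \<notin> P" using that p finite_subset[of P "set ps"] by auto
    then show ?thesis unfolding crosses_weight_def by (rule prod.insert)
  qed
  have "fold (\<lambda>p. nil_factor (snd p) (x_var (fst p))) (ps @ [p]) nil_unit w =
      (\<Sum>P\<in>Pow (set ps). crosses_weight P * c ps P w) +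
      x_var (fst p) * (\<Sum>P\<in>Pow (set ps). crosses_weight P * nil_act (snd p) (c ps P) w)"
    by (simp add: IH nil_factor_def nil_act_def)
  also have "\<dots> = (\<Sum>P\<in>Pow (set ps). crosses_weight P * c (ps @ [p]) P w) +
      (\<Sum>P\<in>Pow (set ps). crosses_weight (insert p P) * c (ps @ [p]) (insert p P) w)"
    by (simp add: sum_distrib_left out inn wt mult.assoc)
  also have "(\<Sum>P\<in>Pow (set ps). crosses_weight (insert p P) * c (ps @ [p]) (insert p P) w) =
      (\<Sum>P\<in>insert p ` Pow (set ps). crosses_weight P * c (ps @ [p]) P w)"
    using p by (intro sum.reindex_cong[symmetric, OF _ refl]) (auto intro!: inj_onI simp: insert_ident)
  also have "(\<Sum>P\<in>Pow (set ps). crosses_weight P * c (ps @ [p]) P w) + \<dots> =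
      (\<Sum>P\<in>Pow (set (ps @ [p])). crosses_weight P * c (ps @ [p]) P w)"
    using p by (subst sum.union_disjoint[symmetric]) (auto simp: Pow_insert)
  finally show ?case by (simp add: c_def)
qed

lemma schubert_gen_pipe_dreams:
  assumes "w permutes {1..n}"
  shows "schubert_gen n w = (\<Sum>P\<in>pipe_dreams n w. crosses_weight P)"
proof -
  have "schubert_gen n w = (\<Sum>P\<in>Pow (staircase n). crosses_weight P * fold nil_act (reading_word n P) nil_unit w)"
    by (simp add: schubert_gen_reading nil_factor_fold_expand distinct_reading set_reading reading_word_def)
  also have "\<dots> = (\<Sum>P\<in>Pow (staircase n). if P \<in> pipe_dreams n w then crosses_weight P else 0)"
  proof (rule sum.cong[OF refl])
    fix P assume "P \<in> Pow (staircase n)"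
    then show "crosses_weight P * fold nil_act (reading_word n P) nil_unit w =
        (if P \<in> pipe_dreams n w then crosses_weight P else 0)"
      using nil_word_coeff[OF set_reading_word assms, of P] demazure_reduced_iff[OF set_reading_word, of n P w]
        length_reading_word[of P n]
      by (auto simp: pipe_dreams_def)
  qed
  also have "\<dots> = (\<Sum>P\<in>pipe_dreams n w. crosses_weight P)"
    using finite_staircase[of n]
    by (subst sum.inter_restrict[symmetric]) (auto simp: pipe_dreams_def intro!: sum.cong)
  finally show ?thesis .
qed

section \<open>Existence of pipe dreams, the longest permutation, and agreement with the
  recursion\<close>

lemma divided_difference_0: "divided_difference i 0 = 0"
  by (rule divided_difference_eqI) simp

text \<open>A zero coefficient at \<open>w\<close> would give a zero coefficient at
  \<open>w \<circ> adj i\<close> for each descent \<open>i\<close>, and descents lead down to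
  \<open>id\<close>, where the only pipe dream is empty and the coefficient is 1.\<close>

lemma schubert_gen_nonzero:
  assumes "w permutes {1..n}"
  shows "schubert_gen n w \<noteq> 0"
  using assms
proof (induction rule: descent_induct)
  case id
  have "pipe_dreams n id = {{}}"
    using finite_subset[OF _ finite_staircase]
    by (auto simp: pipe_dreams_def reading_word_def)
  then have "schubert_gen n id = 1"
    by (simp only: schubert_gen_pipe_dreams[OF permutes_id]) (simp add: crosses_weight_def)
  then show ?case by (metis zero_neq_one)
next
  case (descent w i)
  then show ?case by (metis divided_difference_schubert_gen divided_difference_0)
qed

lemma pipe_dreams_nonempty: "w permutes {1..n} \<Longrightarrow> pipe_dreams n w \<noteq> {}"
  using schubert_gen_nonzero schubert_gen_pipe_dreams by fastforce

lemma longest_perm_permutes: "longest_perm n permutes {1..n}"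
  unfolding longest_perm_def
  by (rule bij_imp_permutes) (auto intro!: bij_betwI[where g = "\<lambda>i. n + 1 - i"])

lemma inv_length_longest_perm: "inv_length n (longest_perm n) = card (staircase n)"
proof -
  have "bij_betw (\<lambda>(r, a). (r, Suc a)) (staircase n)
      {(i, j). 1 \<le> i \<and> i < j \<and> j \<le> n \<and> longest_perm n j < longest_perm n i}"
    by (rule bij_betwI[where g = "\<lambda>(i, j). (i, j - 1)"]) (auto simp: staircase_def longest_perm_def)
  then show ?thesis using bij_betw_same_card unfolding inv_length_def by force
qed

text \<open>The length is the size of the staircase, so the only possible pipe dream is the full
  one; it occurs because some pipe dream exists.\<close>

lemma schubert_gen_longest: "schubert_gen n (longest_perm n) = (\<Prod>i\<in>{1..n}. x_var i ^ (n - i))"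
proof -
  have "P = staircase n" if "P \<in> pipe_dreams n (longest_perm n)" for P
    using that card_subset_eq[OF finite_staircase, of P n] by (auto simp: pipe_dreams_def inv_length_longest_perm)
  then have "pipe_dreams n (longest_perm n) = {staircase n}"
    using pipe_dreams_nonempty[OF longest_perm_permutes, of n] by auto
  then have "schubert_gen n (longest_perm n) = crosses_weight (staircase n)"
    by (simp add: schubert_gen_pipe_dreams longest_perm_permutes)
  also have "staircase n = (SIGMA r:{1..n}. {r..<n})" by (auto simp: staircase_def)
  also have "crosses_weight \<dots> = (\<Prod>i\<in>{1..n}. x_var i ^ (n - i))"
    unfolding crosses_weight_def by (subst prod.Sigma[symmetric, where g = "\<lambda>r a. x_var r", simplified case_prod_unfold]) auto
  finally show ?thesis .
qed

lemma inv_length_le_staircase: "inv_length n w \<le> card (staircase n)"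
proof -
  have "inv_length n w \<le> card {(i, j). 1 \<le> i \<and> i < j \<and> j \<le> n \<and> longest_perm n j < longest_perm n i}"
    unfolding inv_length_def
    by (rule card_mono[OF finite_subset[of _ "{1..n} \<times> {1..n}"]]) (auto simp: longest_perm_def)
  then show ?thesis using inv_length_longest_perm[of n] by (simp add: inv_length_def)
qed

lemma no_ascent_imp_longest:
  assumes w: "w permutes {1..n}" and no: "\<And>i. 1 \<le> i \<Longrightarrow> i < n \<Longrightarrow> \<not> w i < w (Suc i)"
  shows "w = longest_perm n"
proof -
  have "longest_perm n \<circ> w = id"
  proof (rule no_descent_imp_id)
    show "longest_perm n \<circ> w permutes {1..n}" by (rule permutes_compose[OF w longest_perm_permutes])
    fix i assume i: "1 \<le> i" "i < n"
    then have "w i \<in> {1..n}" "w (Suc i) \<in> {1..n}" using permutes_in_image[OF w] by auto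
    then show "\<not> (longest_perm n \<circ> w) (Suc i) < (longest_perm n \<circ> w) i"
      using no[OF i] by (auto simp: longest_perm_def)
  qed
  moreover have "longest_perm n \<circ> longest_perm n = id" by (auto simp: longest_perm_def fun_eq_iff)
  ultimately show ?thesis by (metis comp_assoc comp_id id_comp)
qed

text \<open>Derivations start at the longest permutation, so the induction climbs along ascents, on
  the distance of the length from its maximum.\<close>

lemma schubert_rel_schubert_gen:
  assumes "w permutes {1..n}"
  shows "schubert_rel n w (schubert_gen n w)"
  using assms
proof (induction "card (staircase n) - inv_length n w" arbitrary: w rule: less_induct)
  case less
  show ?case
  proof (cases "w = longest_perm n")
    case True
    then show ?thesis using schubert_rel.longest[of n] by (simp add: schubert_gen_longest)
  next
    case False
    then obtain i where i: "1 \<le> i" "i < n" "w i < w (Suc i)"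
      using no_ascent_imp_longest[OF less.prems] by blast
    let ?v = "w \<circ> adj i"
    have "card (staircase n) - inv_length n ?v < card (staircase n) - inv_length n w"
      using inv_length_adj_ascent[OF less.prems i] inv_length_le_staircase[of n ?v] by linarith
    then have "schubert_rel n ?v (schubert_gen n ?v)"
      using less i by (simp add: permutes_comp_adj)
    then have "schubert_rel n (?v \<circ> adj i) (divided_difference i (schubert_gen n ?v))"
      using i by (intro schubert_rel.descent) auto
    then show ?thesis
      using divided_difference_schubert_gen[of i n ?v] i by simp
  qed
qed

text \<open>This is the independence of the chain of descents: each derivation computes a
  coefficient of the same element, so no braid relations among divided differences enter.\<close>

lemma schubert_rel_unique:
  "schubert_rel n w f \<Longrightarrow> w permutes {1..n} \<and> f = schubert_gen n w"
proof (induction rule: schubert_rel.induct)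
  case longest
  show ?case by (simp add: schubert_gen_longest longest_perm_permutes)
next
  case (descent w f i)
  then have "f = schubert_gen n w" by blast
  then show ?case
    using descent permutes_comp_adj(1) divided_difference_schubert_gen by metis
qed

theorem schubert_pipe_dreams:
  assumes "w permutes {1..n}"
  shows "schubert n w = (\<Sum>P\<in>pipe_dreams n w. crosses_weight P)"
proof -
  have "schubert n w = schubert_gen n w"
    unfolding schubert_def using schubert_rel_schubert_gen[OF assms] schubert_rel_unique by blast
  then show ?thesis using schubert_gen_pipe_dreams[OF assms] by simp
qed

section \<open>Bruhat order\<close>

definition perm_rank :: "(nat \<Rightarrow> nat) \<Rightarrow> nat \<Rightarrow> nat \<Rightarrow> nat" where
  "perm_rank w i j = card {k \<in> {1..i}. w k \<le> j}"

lemma perm_rank_0 [simp]: "perm_rank w 0 j = 0"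
  by (simp add: perm_rank_def)

lemma perm_rank_Suc: "perm_rank w (Suc i) j = perm_rank w i j + of_bool (w (Suc i) \<le> j)"
proof -
  have "{k \<in> {1..Suc i}. w k \<le> j} =
      (if w (Suc i) \<le> j then insert (Suc i) {k \<in> {1..i}. w k \<le> j} else {k \<in> {1..i}. w k \<le> j})"
    by (auto simp: le_Suc_eq)
  then show ?thesis by (simp add: perm_rank_def)
qed

lemma perm_rank_mono: "i \<le> i' \<Longrightarrow> perm_rank w i j \<le> perm_rank w i' j"
  unfolding perm_rank_def by (rule card_mono) auto

lemma perm_rank_le: "perm_rank w i j \<le> i"
proof -
  have "perm_rank w i j \<le> card {1..i}" unfolding perm_rank_def by (rule card_mono) auto
  then show ?thesis by simp
qed

lemma perm_rank_le_add: "perm_rank w (i + m) j \<le> perm_rank w i j + m"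
  by (induction m) (auto simp: perm_rank_Suc)

lemma perm_rank_full:
  assumes "w permutes {1..n}" "j \<le> n"
  shows "perm_rank w n j = j"
proof -
  have "w ` {k \<in> {1..n}. w k \<le> j} = {1..j}"
  proof
    show "{1..j} \<subseteq> w ` {k \<in> {1..n}. w k \<le> j}"
    proof
      fix x assume x: "x \<in> {1..j}"
      then have "x \<in> w ` {1..n}" using permutes_image[OF assms(1)] assms(2) by auto
      then show "x \<in> w ` {k \<in> {1..n}. w k \<le> j}" using x by auto
    qed
  qed (use permutes_in_image[OF assms(1)] in force)
  moreover have "card (w ` {k \<in> {1..n}. w k \<le> j}) = perm_rank w n j"
    unfolding perm_rank_def by (rule card_image) (rule permutes_inj_on[OF assms(1)])
  ultimately show ?thesis by simp
qed

lemma perm_rank_right: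
  assumes "w permutes {1..n}" "i \<le> n"
  shows "perm_rank w i n = i"
proof -
  have "{k \<in> {1..i}. w k \<le> n} = {1..i}"
  proof -
    have "w k \<le> n" if "k \<in> {1..i}" for k
    proof -
      have "w k \<in> {1..n}" using that assms by (simp only: permutes_in_image[OF assms(1)]) simp
      then show ?thesis by simp
    qed
    then show ?thesis by blast
  qed
  then show ?thesis by (simp add: perm_rank_def)
qed

lemma perm_rank_Suc_right:
  assumes "w permutes {1..n}"
  shows "perm_rank w i j \<le> perm_rank w i (Suc j) \<and> perm_rank w i (Suc j) \<le> Suc (perm_rank w i j)"
proof
  show "perm_rank w i j \<le> perm_rank w i (Suc j)" unfolding perm_rank_def by (rule card_mono) auto
  have "{k \<in> {1..i}. w k \<le> Suc j} \<subseteq> insert (pinv w (Suc j)) {k \<in> {1..i}. w k \<le> j}"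
    using permutes_inverses(2)[OF assms] by (auto simp: le_Suc_eq) (metis)
  then have "perm_rank w i (Suc j) \<le> card (insert (pinv w (Suc j)) {k \<in> {1..i}. w k \<le> j})"
    unfolding perm_rank_def by (rule card_mono[rotated]) auto
  also have "\<dots> \<le> Suc (perm_rank w i j)" unfolding perm_rank_def by (rule card_insert_le_m1[of _ _ , simplified]) auto
  finally show "perm_rank w i (Suc j) \<le> Suc (perm_rank w i j)" .
qed

lemma corner_sum_perm_mat:
  assumes w: "w permutes {1..n}" and "i \<le> n" "j \<le> n"
  shows "corner_sum (perm_mat n w) i j = int (perm_rank w i j)"
  using assms(2)
proof (induction i)
  case (Suc i)
  have "(\<Sum>l<j. perm_mat n w $$ (i, l)) = (\<Sum>l<j. if l = w (Suc i) - 1 then of_bool (w (Suc i) \<le> j) else 0)"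
  proof (rule sum.cong[OF refl])
    fix l assume "l \<in> {..<j}"
    moreover have "w (Suc i) \<in> {1..n}" using Suc.prems by (simp only: permutes_in_image[OF w]) simp
    ultimately show "perm_mat n w $$ (i, l) = (if l = w (Suc i) - 1 then of_bool (w (Suc i) \<le> j) else 0)"
      using Suc.prems assms(3) by (auto simp: perm_mat_def)
  qed
  also have "\<dots> = of_bool (w (Suc i) \<le> j)"
  proof -
    have "w (Suc i) \<in> {1..n}" using Suc.prems by (simp only: permutes_in_image[OF w]) simp
    then show ?thesis by auto
  qed
  finally show ?case using Suc by (simp add: corner_sum_def perm_rank_Suc)
qed (simp add: corner_sum_def)

lemma bruhat_le_iff:
  assumes "v permutes {1..n}" "w permutes {1..n}"
  shows "bruhat_le n v w \<longleftrightarrow> (\<forall>i\<in>{1..n}. \<forall>j\<in>{1..n}. perm_rank w i j \<le> perm_rank v i j)"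
  by (simp add: bruhat_le_def asm_le_def corner_sum_perm_mat assms)

lemma perm_rank_adj:
  "perm_rank (w \<circ> adj (Suc i)) p q =
    (if p = Suc i then perm_rank w i q + of_bool (w (Suc (Suc i)) \<le> q) else perm_rank w p q)"
proof (induction p)
  case (Suc p)
  consider "p = i" | "p = Suc i" | "p \<noteq> i" "p \<noteq> Suc i" by blast
  then show ?case
    by cases (use Suc in \<open>simp_all add: perm_rank_Suc\<close>)
qed simp

text \<open>A lifting property. Only row \<open>i\<close> of the ranks changes. If
  \<open>v' i \<le> q\<close>, the rank of \<open>v'\<close> there is one more than in the row
  before, the most that \<open>w \<circ> adj i\<close> can reach. Otherwise
  \<open>v' (Suc i)\<close> exceeds \<open>q\<close> too, as \<open>v'\<close> ascends at
  \<open>i\<close>, and the rank of \<open>v'\<close> already equals that in row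
  \<open>Suc i\<close>.\<close>

lemma bruhat_lifting:
  assumes v: "v permutes {1..n}" and w: "w permutes {1..n}"
    and le: "\<forall>p\<in>{1..n}. \<forall>q\<in>{1..n}. perm_rank w p q \<le> perm_rank v p q"
    and i: "1 \<le> i" "i < n"
    and v': "v' = (if v (Suc i) < v i then v \<circ> adj i else v)"
    and pq: "p \<in> {1..n}" "q \<in> {1..n}"
  shows "perm_rank (w \<circ> adj i) p q \<le> perm_rank v' p q"
proof -
  obtain h where h: "i = Suc h" using i by (cases i) auto
  have other: "perm_rank v' k q = perm_rank v k q" "perm_rank (w \<circ> adj i) k q = perm_rank w k q"
    if "k \<noteq> i" for k
    using that by (simp_all add: v' h perm_rank_adj)
  show ?thesis
  proof (cases "p = i")
    case True
    have wh: "perm_rank w h q \<le> perm_rank v h q"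
    proof (cases "h = 0")
      case False
      then show ?thesis using le i pq h by auto
    qed simp
    have wi: "perm_rank w (Suc (Suc h)) q \<le> perm_rank v (Suc (Suc h)) q" using le i pq h by auto
    have asc: "v' (Suc h) \<le> v' (Suc (Suc h))" by (auto simp: v' h)
    have w1: "perm_rank (w \<circ> adj i) i q = perm_rank w h q + of_bool (w (Suc (Suc h)) \<le> q)"
      by (simp add: h perm_rank_adj)
    have v1: "perm_rank v' (Suc h) q = perm_rank v h q + of_bool (v' (Suc h) \<le> q)"
      using other(1)[of h] h by (simp add: perm_rank_Suc)
    have v2: "perm_rank v (Suc (Suc h)) q = perm_rank v' (Suc h) q + of_bool (v' (Suc (Suc h)) \<le> q)"
      using other(1)[of "Suc (Suc h)"] h by (simp add: perm_rank_Suc)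
    show ?thesis
    proof (cases "v' (Suc h) \<le> q")
      case True
      then show ?thesis using w1 v1 wh \<open>p = i\<close> h by simp
    next
      case False
      then have "perm_rank v (Suc (Suc h)) q = perm_rank v' (Suc h) q" using v2 asc by simp
      moreover have "perm_rank w h q + of_bool (w (Suc (Suc h)) \<le> q) \<le> perm_rank w (Suc (Suc h)) q"
        by (simp add: perm_rank_Suc)
      ultimately show ?thesis using w1 wi \<open>p = i\<close> h by simp
    qed
  qed (use other le pq in auto)
qed

lemma bruhat_le_id:
  assumes v: "v permutes {1..n}" and le: "\<forall>p\<in>{1..n}. \<forall>q\<in>{1..n}. perm_rank id p q \<le> perm_rank v p q"
  shows "v = id"
proof -
  have "v i \<le> i" if i: "i \<in> {1..n}" for i
  proof -
    have "perm_rank id i i = i"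
    proof -
      have "{k \<in> {1..i}. id k \<le> i} = {1..i}" by auto
      then show ?thesis by (simp add: perm_rank_def)
    qed
    moreover have "perm_rank id i i \<le> perm_rank v i i" using le i by blast
    ultimately have "card {1..i} \<le> card {k \<in> {1..i}. v k \<le> i}" by (simp add: perm_rank_def)
    then have "{k \<in> {1..i}. v k \<le> i} = {1..i}" by (intro card_seteq) auto
    moreover have "i \<in> {1..i}" using i by simp
    ultimately show ?thesis by blast
  qed
  then show ?thesis by (intro permutes_natset_le[OF v]) auto
qed

text \<open>Needed to see that permutations of least length are Bruhat-minimal. Along descents of
  \<open>w\<close>, lifting compares \<open>w \<circ> adj i\<close> with \<open>v'\<close>, and
  \<open>v'\<close> is at most one shorter than \<open>v\<close>; equal lengths exclude the case
  \<open>v' = v\<close>.\<close>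

theorem bruhat_le_inv_length:
  assumes "v permutes {1..n}" "w permutes {1..n}" "bruhat_le n v w"
  shows "inv_length n v \<le> inv_length n w \<and> (inv_length n v = inv_length n w \<longrightarrow> v = w)"
proof -
  have "\<forall>p\<in>{1..n}. \<forall>q\<in>{1..n}. perm_rank w p q \<le> perm_rank v p q"
    using assms bruhat_le_iff by blast
  with assms(2,1) show ?thesis
  proof (induction arbitrary: v rule: descent_induct)
    case id
    then show ?case using bruhat_le_id by blast
  next
    case (descent w i)
    define v' where "v' = (if v (Suc i) < v i then v \<circ> adj i else v)"
    have perm: "v' permutes {1..n}" using descent by (simp add: v'_def permutes_comp_adj)
    have "\<forall>p\<in>{1..n}. \<forall>q\<in>{1..n}. perm_rank (w \<circ> adj i) p q \<le> perm_rank v' p q"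
      using bruhat_lifting[OF descent.prems(1) descent.hyps(1) descent.prems(2) descent.hyps(2,3) v'_def] by blast
    then have IH: "inv_length n v' \<le> inv_length n (w \<circ> adj i)"
      "inv_length n v' = inv_length n (w \<circ> adj i) \<Longrightarrow> v' = w \<circ> adj i"
      using descent.IH[OF perm] by (simp_all add: o_def)
    have w: "inv_length n w = Suc (inv_length n (w \<circ> adj i))"
      by (rule inv_length_adj_descent[OF descent.hyps(1-4)])
    show ?case
    proof (cases "v (Suc i) < v i")
      case True
      then have v: "inv_length n v = Suc (inv_length n (v \<circ> adj i))"
        by (rule inv_length_adj_descent[OF descent.prems(1) descent.hyps(2,3)])
      have eq: "v' = v \<circ> adj i" using True by (simp add: v'_def)
      have "v = w" if "v \<circ> adj i = w \<circ> adj i"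
        using that by (metis adj_comp_adj(1))
      then show ?thesis using IH v w unfolding eq by linarith
    next
      case False
      then have "v' = v" by (simp add: v'_def)
      then show ?thesis using IH w by simp
    qed
  qed
qed

section \<open>Joins of alternating sign matrices\<close>

text \<open>These are the corner sum functions of alternating sign matrices, in a form visibly
  preserved by entrywise minimum.\<close>

definition corner_function :: "nat \<Rightarrow> (nat \<Rightarrow> nat \<Rightarrow> int) \<Rightarrow> bool" where
  "corner_function n r \<longleftrightarrow>
    (\<forall>i\<le>n. r i 0 = 0 \<and> r 0 i = 0 \<and> r i n = int i \<and> r n i = int i) \<and>
    (\<forall>i<n. \<forall>j\<le>n. r (Suc i) j - r i j \<in> {0, 1} \<and> r j (Suc i) - r j i \<in> {0, 1})"

lemma corner_function_perm_mat:
  assumes "w permutes {1..n}"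
  shows "corner_function n (corner_sum (perm_mat n w))"
proof -
  have 1: "corner_sum (perm_mat n w) i 0 = 0 \<and> corner_sum (perm_mat n w) 0 i = 0 \<and>
      corner_sum (perm_mat n w) i n = int i \<and> corner_sum (perm_mat n w) n i = int i" if "i \<le> n" for i
    using that corner_sum_perm_mat[OF assms] perm_rank_full[OF assms] perm_rank_right[OF assms]
    by (simp add: corner_sum_def)
  have 2: "corner_sum (perm_mat n w) (Suc i) j - corner_sum (perm_mat n w) i j \<in> {0, 1} \<and>
      corner_sum (perm_mat n w) j (Suc i) - corner_sum (perm_mat n w) j i \<in> {0, 1}" if "i < n" "j \<le> n" for i j
  proof -
    have "perm_rank w j (Suc i) = perm_rank w j i \<or> perm_rank w j (Suc i) = Suc (perm_rank w j i)"
      using perm_rank_Suc_right[OF assms, of j i] by linarith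
    then show ?thesis
      using that by (auto simp: corner_sum_perm_mat[OF assms] perm_rank_Suc)
  qed
  show ?thesis unfolding corner_function_def using 1 2 by blast
qed

text \<open>With \<open>g\<close> minimal at \<open>x\<close> and \<open>f\<close> minimal at
  \<open>y\<close>: \<open>f y \<le> f x \<le> g x \<le> g y \<le> f y + 1\<close>.\<close>

lemma Min_diff_bounded:
  fixes f g :: "'a \<Rightarrow> int"
  assumes "finite S" "S \<noteq> {}" and d: "\<And>x. x \<in> S \<Longrightarrow> g x - f x \<in> {0, 1}"
  shows "Min (g ` S) - Min (f ` S) \<in> {0, 1}"
proof -
  obtain x where x: "x \<in> S" "Min (g ` S) = g x"
  proof -
    have "Min (g ` S) \<in> g ` S" using assms(1,2) by (intro Min_in) simp_all
    then show thesis using that by blast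
  qed
  obtain y where y: "y \<in> S" "Min (f ` S) = f y"
  proof -
    have "Min (f ` S) \<in> f ` S" using assms(1,2) by (intro Min_in) simp_all
    then show thesis using that by blast
  qed
  have "f y \<le> f x" using y x(1) assms(1) by (metis Min_le finite_imageI imageI)
  moreover have "g x \<le> g y" using x y(1) assms(1) by (metis Min_le finite_imageI imageI)
  ultimately show ?thesis using d[OF x(1)] d[OF y(1)] x(2) y(2) by auto
qed

lemma corner_function_Min:
  assumes "finite S" "S \<noteq> {}" "\<And>A. A \<in> S \<Longrightarrow> corner_function n (corner_sum A)"
  shows "corner_function n (\<lambda>i j. Min ((\<lambda>A. corner_sum A i j) ` S))"
proof -
  have const: "Min ((\<lambda>A. corner_sum A i j) ` S) = c" if "\<And>A. A \<in> S \<Longrightarrow> corner_sum A i j = c" for i j c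
  proof -
    have "(\<lambda>A. corner_sum A i j) ` S = {c}" using that assms(2) by auto
    then show ?thesis by simp
  qed
  show ?thesis
    unfolding corner_function_def
  proof (intro conjI allI impI)
    fix i assume "i \<le> n"
    then show "Min ((\<lambda>A. corner_sum A i 0) ` S) = 0" "Min ((\<lambda>A. corner_sum A 0 i) ` S) = 0"
      "Min ((\<lambda>A. corner_sum A i n) ` S) = int i" "Min ((\<lambda>A. corner_sum A n i) ` S) = int i"
      using assms(3) unfolding corner_function_def by (blast intro: const)+
  next
    fix i j assume ij: "i < n" "j \<le> n"
    then have diff: "corner_sum A (Suc i) j - corner_sum A i j \<in> {0, 1} \<and>
        corner_sum A j (Suc i) - corner_sum A j i \<in> {0, 1}" if "A \<in> S" for A
      using assms(3)[OF that] unfolding corner_function_def by blast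
    show "Min ((\<lambda>A. corner_sum A (Suc i) j) ` S) - Min ((\<lambda>A. corner_sum A i j) ` S) \<in> {0, 1}"
      by (rule Min_diff_bounded[OF assms(1,2)]) (use diff in blast)
    show "Min ((\<lambda>A. corner_sum A j (Suc i)) ` S) - Min ((\<lambda>A. corner_sum A j i) ` S) \<in> {0, 1}"
      by (rule Min_diff_bounded[OF assms(1,2)]) (use diff in blast)
  qed
qed

text \<open>The partial sums stay in 0 and 1, and each nonzero entry is a move between these values,
  so consecutive moves go in opposite directions.\<close>

lemma alternating_sign_vecI:
  assumes sums: "\<And>k. k \<le> dim_vec v \<Longrightarrow> (\<Sum>j<k. v $ j) \<in> {0, 1}" and total: "(\<Sum>j<dim_vec v. v $ j) = 1"
  shows "alternating_sign_vec v"
  unfolding alternating_sign_vec_def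
proof (intro conjI allI impI)
  fix j assume "j < dim_vec v"
  then show "v $ j \<in> {-1, 0, 1}" using sums[of j] sums[of "Suc j"] by auto
next
  fix j j' assume a: "j < j' \<and> j' < dim_vec v \<and> v $ j \<noteq> 0 \<and> v $ j' \<noteq> 0 \<and> (\<forall>l. j < l \<and> l < j' \<longrightarrow> v $ l = 0)"
  have "(\<Sum>l<j'. v $ l) = (\<Sum>l<Suc j. v $ l)"
    by (rule sum.mono_neutral_right) (use a in \<open>auto simp: less_Suc_eq\<close>)
  then show "v $ j' = - v $ j"
    using sums[of j] sums[of "Suc j"] sums[of "Suc j'"] a by auto
qed (rule total)

lemma corner_function_ASM:
  assumes r: "corner_function n r"
  shows "\<exists>A\<in>ASM n. \<forall>i\<le>n. \<forall>j\<le>n. corner_sum A i j = r i j"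
proof -
  \<comment> \<open>The mixed second difference of \<open>r\<close>. Its partial sums along rows and
    columns telescope to first differences of \<open>r\<close>, which are 0 or 1.\<close>
  define A where "A = mat n n (\<lambda>(i, j). r (Suc i) (Suc j) - r i (Suc j) - (r (Suc i) j - r i j))"
  have bd: "r i 0 = 0" "r 0 i = 0" "r i n = int i" "r n i = int i" if "i \<le> n" for i
    using r that by (auto simp: corner_function_def)
  have diff: "r (Suc i) j - r i j \<in> {0, 1}" "r j (Suc i) - r j i \<in> {0, 1}" if "i < n" "j \<le> n" for i j
    using r that unfolding corner_function_def by blast+
  have row: "(\<Sum>l<j. A $$ (i, l)) = r (Suc i) j - r i j" if "i < n" "j \<le> n" for i j
    using that(2)
  proof (induction j)
    case 0
    then show ?case using bd(1)[of i] bd(1)[of "Suc i"] that by simp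
  next
    case (Suc j)
    then show ?case using that by (simp add: A_def)
  qed
  have col: "(\<Sum>l<i. A $$ (l, j)) = r i (Suc j) - r i j" if "j < n" "i \<le> n" for i j
    using that(2)
  proof (induction i)
    case 0
    then show ?case using bd(2)[of j] bd(2)[of "Suc j"] that by simp
  next
    case (Suc i)
    then show ?case using that by (simp add: A_def)
  qed
  have dim: "A \<in> carrier_mat n n" by (simp add: A_def)
  have "alternating_sign_vec (Matrix.row A i)" if i: "i < n" for i
  proof (rule alternating_sign_vecI)
    have pre: "(\<Sum>j<k. Matrix.row A i $ j) = r (Suc i) k - r i k" if "k \<le> n" for k
      using row[OF i that] that i dim by (simp add: Matrix.row_def)
    show "(\<Sum>j<k. Matrix.row A i $ j) \<in> {0, 1}" if "k \<le> dim_vec (Matrix.row A i)" for k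
      using that dim pre[of k] diff(1)[OF i, of k] by simp
    show "(\<Sum>j<dim_vec (Matrix.row A i). Matrix.row A i $ j) = 1"
      using dim pre[of n] bd(3)[of i] bd(3)[of "Suc i"] i by simp
  qed
  moreover have "alternating_sign_vec (Matrix.col A i)" if i: "i < n" for i
  proof (rule alternating_sign_vecI)
    have pre: "(\<Sum>j<k. Matrix.col A i $ j) = r k (Suc i) - r k i" if "k \<le> n" for k
      using col[OF i that] that i dim by (simp add: Matrix.col_def)
    show "(\<Sum>j<k. Matrix.col A i $ j) \<in> {0, 1}" if "k \<le> dim_vec (Matrix.col A i)" for k
      using that dim pre[of k] diff(2)[OF i, of k] by simp
    show "(\<Sum>j<dim_vec (Matrix.col A i). Matrix.col A i $ j) = 1"
      using dim pre[of n] bd(4)[of i] bd(4)[of "Suc i"] i by simp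
  qed
  ultimately have "A \<in> ASM n" using dim by (simp add: ASM_def)
  moreover have "corner_sum A i j = r i j" if "i \<le> n" "j \<le> n" for i j
    using that(1)
  proof (induction i)
    case 0
    then show ?case using bd(2)[OF that(2)] by (simp add: corner_sum_def)
  next
    case (Suc i)
    then show ?case using row[of i j] that by (simp add: corner_sum_def)
  qed
  ultimately show ?thesis by blast
qed

lemma ASM_eqI:
  assumes "A \<in> ASM n" "B \<in> ASM n"
    and eq: "\<And>i j. i \<in> {1..n} \<Longrightarrow> j \<in> {1..n} \<Longrightarrow> corner_sum A i j = corner_sum B i j"
  shows "A = B"
proof -
  have eq': "corner_sum A i j = corner_sum B i j" if "i \<le> n" "j \<le> n" for i j
  proof (cases "i = 0 \<or> j = 0")
    case False
    then show ?thesis using that eq by simp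
  qed (auto simp: corner_sum_def)
  have entry: "A $$ (i, j) = corner_sum A (Suc i) (Suc j) - corner_sum A i (Suc j) -
      corner_sum A (Suc i) j + corner_sum A i j" for A i j
    by (simp add: corner_sum_def)
  show ?thesis
  proof (rule eq_matI)
    fix i j assume "i < dim_row B" "j < dim_col B"
    then show "A $$ (i, j) = B $$ (i, j)"
      using assms(2) eq' by (auto simp: entry ASM_def)
  qed (use assms(1,2) in \<open>auto simp: ASM_def\<close>)
qed

lemma corner_sum_asm_join:
  assumes "finite S" "S \<noteq> {}" "\<And>A. A \<in> S \<Longrightarrow> corner_function n (corner_sum A)"
    and "i \<in> {1..n}" "j \<in> {1..n}"
  shows "corner_sum (asm_join n S) i j = Min ((\<lambda>A. corner_sum A i j) ` S)"
proof -
  let ?P = "\<lambda>C. C \<in> ASM n \<and> (\<forall>i\<in>{1..n}. \<forall>j\<in>{1..n}. corner_sum C i j = Min ((\<lambda>A. corner_sum A i j) ` S))"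
  obtain C where C: "C \<in> ASM n" "\<forall>i\<le>n. \<forall>j\<le>n. corner_sum C i j = Min ((\<lambda>A. corner_sum A i j) ` S)"
    using corner_function_ASM[OF corner_function_Min[OF assms(1-3)]] by blast
  then have "?P C" by simp
  moreover have "D = C" if "?P D" for D
    by (rule ASM_eqI[of _ n]) (use that \<open>?P C\<close> in simp_all)
  ultimately have "?P (asm_join n S)" unfolding asm_join_def by (rule theI[of ?P])
  then show ?thesis using assms(4,5) by blast
qed

lemma perms_above_asm_join:
  assumes "finite U" "U \<noteq> {}" "\<And>u. u \<in> U \<Longrightarrow> u permutes {1..n}"
  shows "perms_above n (asm_join n (perm_mat n ` U)) =
    {w. w permutes {1..n} \<and> (\<forall>u\<in>U. bruhat_le n u w)}"
proof -
  have "corner_sum (asm_join n (perm_mat n ` U)) i j =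
      Min ((\<lambda>u. corner_sum (perm_mat n u) i j) ` U)" if "i \<in> {1..n}" "j \<in> {1..n}" for i j
    using corner_sum_asm_join[of "perm_mat n ` U" n i j] that assms corner_function_perm_mat
    by (auto simp: image_image)
  then have "asm_le n (asm_join n (perm_mat n ` U)) B \<longleftrightarrow> (\<forall>u\<in>U. asm_le n (perm_mat n u) B)" for B
    using assms(1,2) by (auto simp: asm_le_def)
  then show ?thesis by (auto simp: perms_above_def bruhat_le_def)
qed

section \<open>Grassmannian permutations\<close>

lemma strict_mono_on_image_eq:
  fixes f g :: "nat \<Rightarrow> nat"
  assumes "strict_mono_on S f" "strict_mono_on S g" "f ` S = g ` S" "k \<in> S"
  shows "f k = g k"
  using assms(4)
proof (induction k rule: less_induct)
  case (less k)
  have no: "\<not> f k < g k" if f: "strict_mono_on S f" and g: "strict_mono_on S g" and im: "f ` S = g ` S"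
    and IH: "\<And>m. m < k \<Longrightarrow> m \<in> S \<Longrightarrow> f m = g m" for f g :: "nat \<Rightarrow> nat"
  proof
    assume lt: "f k < g k"
    have "f k \<in> g ` S" using im less.prems by blast
    then obtain m where m: "m \<in> S" "f k = g m" by blast
    then have "m < k" using lt g less.prems by (metis linorder_less_linear order.asym strict_mono_onD)
    then show False using IH[OF _ m(1)] m strict_mono_onD[OF f m(1) less.prems] by simp
  qed
  show ?case using no[of f g] no[of g f] assms(1-3) less.IH by (metis linorder_less_linear)
qed

lemma grass_perm_exists:
  fixes g :: "nat \<Rightarrow> nat"
  assumes g: "strict_mono_on {1..d} g" "g ` {1..d} \<subseteq> {1..n}"
  shows "\<exists>!u. u permutes {1..n} \<and> (\<forall>k\<in>{1..d}. u k = g k) \<and> strict_mono_on {d + 1..n} u"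
proof -
  have injg: "inj_on g {1..d}" using g(1) by (rule strict_mono_on_imp_inj_on)
  have dn: "d \<le> n" using card_inj_on_le[OF injg g(2)] by simp
  define C where "C = {1..n} - g ` {1..d}"
  have cardC: "card C = n - d"
    unfolding C_def using g(2) injg by (subst card_Diff_subset) (auto simp: card_image)
  define xs where "xs = sorted_list_of_set C"
  have xs: "set xs = C" "length xs = n - d" "sorted_wrt (<) xs"
    using cardC by (auto simp: xs_def C_def)
  define u where "u k = (if k \<in> {1..d} then g k else if k \<in> {d + 1..n} then xs ! (k - d - 1) else k)" for k
  have mono: "strict_mono_on {d + 1..n} u"
    by (rule strict_mono_onI) (use xs in \<open>auto simp: u_def intro!: sorted_wrt_nth_less[of "(<)"]\<close>)
  have im2: "u ` {d + 1..n} = C"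
  proof -
    have "u ` {d + 1..n} \<subseteq> C" using xs by (auto simp: u_def intro!: nth_mem)
    moreover have "card (u ` {d + 1..n}) = card C"
      using card_image[OF strict_mono_on_imp_inj_on[OF mono]] cardC by simp
    ultimately show ?thesis by (intro card_subset_eq) (auto simp: C_def)
  qed
  have im1: "u ` {1..d} = g ` {1..d}" by (intro image_cong) (auto simp: u_def)
  have split: "{1..n} = {1..d} \<union> {d + 1..n}" using dn by auto
  have im: "u ` {1..n} = {1..n}" unfolding split image_Un im1 im2 using g(2) split by (auto simp: C_def)
  have "u permutes {1..n}"
  proof (rule bij_imp_permutes)
    show "bij_betw u {1..n} {1..n}" unfolding bij_betw_def using im by (auto intro: eq_card_imp_inj_on)
    show "u x = x" if "x \<notin> {1..n}" for x using that dn by (auto simp: u_def)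
  qed
  moreover have "\<forall>k\<in>{1..d}. u k = g k" by (simp add: u_def)
  moreover have "v = u" if v: "v permutes {1..n}" "\<forall>k\<in>{1..d}. v k = g k" "strict_mono_on {d + 1..n} v" for v
  proof
    have "v ` {d + 1..n} = C"
    proof -
      have "v ` {1..d} = g ` {1..d}" using v(2) by (intro image_cong) auto
      moreover have "{d + 1..n} = {1..n} - {1..d}" by auto
      ultimately show ?thesis
        unfolding C_def using image_set_diff[OF permutes_inj[OF v(1)], of "{1..n}" "{1..d}"] permutes_image[OF v(1)]
        by simp
    qed
    then have *: "v k = u k" if "k \<in> {d + 1..n}" for k
      using strict_mono_on_image_eq[OF v(3) mono _ that] im2 by simp
    fix k show "v k = u k"
    proof (cases "k \<in> {1..n}")
      case True
      then show ?thesis using * v(2) split by (auto simp: u_def)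
    next
      case False
      then show ?thesis using v(1) \<open>u permutes {1..n}\<close> by (simp add: permutes_def)
    qed
  qed
  ultimately show ?thesis using mono by blast
qed

text \<open>Since \<open>u\<close> increases on both blocks, its rank at \<open>(i, j)\<close> is
  determined by row \<open>d\<close>. For \<open>i \<le> d\<close> it is either the maximum
  \<open>i\<close> or the rank in row \<open>d\<close>. For \<open>i > d\<close> it is either the
  rank in row \<open>d\<close> plus \<open>i - d\<close>, the fastest possible growth, or the full
  rank \<open>j\<close>. The test \<open>u i \<le> j\<close> decides which.\<close>

lemma bruhat_le_grassmannian:
  assumes u: "u permutes {1..n}" and w: "w permutes {1..n}" and d: "d \<le> n"
    and lo: "strict_mono_on {1..d} u" and hi: "strict_mono_on {d + 1..n} u"
  shows "bruhat_le n u w \<longleftrightarrow> (\<forall>j\<in>{1..n}. perm_rank w d j \<le> perm_rank u d j)"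
proof
  assume "bruhat_le n u w"
  then show "\<forall>j\<in>{1..n}. perm_rank w d j \<le> perm_rank u d j"
    using bruhat_le_iff[OF u w] d by (cases "d = 0") auto
next
  assume le: "\<forall>j\<in>{1..n}. perm_rank w d j \<le> perm_rank u d j"
  have "perm_rank w i j \<le> perm_rank u i j" if ij: "i \<in> {1..n}" "j \<in> {1..n}" for i j
  proof (cases "i \<le> d")
    case i: True
    show ?thesis
    proof (cases "u i \<le> j")
      case True
      have "u k \<le> j" if "k \<in> {1..i}" for k
      proof (cases "k = i")
        case False
        then have "u k < u i" using that i by (intro strict_mono_onD[OF lo]) auto
        then show ?thesis using True by simp
      qed (use True in simp)
      then have "{k \<in> {1..i}. u k \<le> j} = {1..i}" by auto
      then have "perm_rank u i j = i" by (simp add: perm_rank_def)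
      then show ?thesis using perm_rank_le[of w i j] by simp
    next
      case False
      have "k \<le> i" if "k \<in> {1..d}" "u k \<le> j" for k
      proof (rule ccontr)
        assume "\<not> k \<le> i"
        then have "u i < u k" using that ij by (intro strict_mono_onD[OF lo]) auto
        then show False using that False by simp
      qed
      then have "{k \<in> {1..d}. u k \<le> j} \<subseteq> {k \<in> {1..i}. u k \<le> j}" by auto
      then have "perm_rank u d j \<le> perm_rank u i j" unfolding perm_rank_def by (intro card_mono) auto
      then show ?thesis using perm_rank_mono[OF i, of w j] le ij by force
    qed
  next
    case i: False
    show ?thesis
    proof (cases "u i \<le> j")
      case True
      have *: "u k \<le> j" if "k \<in> {d + 1..i}" for k
      proof (cases "k = i")
        case False
        then have "u k < u i" using that ij by (intro strict_mono_onD[OF hi]) auto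
        then show ?thesis using True by simp
      qed (use True in simp)
      have "{k \<in> {1..i}. u k \<le> j} = {k \<in> {1..d}. u k \<le> j} \<union> {d + 1..i}" using i * by auto
      moreover have "card ({k \<in> {1..d}. u k \<le> j} \<union> {d + 1..i}) = perm_rank u d j + (i - d)"
        unfolding perm_rank_def by (subst card_Un_disjoint) auto
      ultimately have "perm_rank u i j = perm_rank u d j + (i - d)" by (simp add: perm_rank_def)
      moreover have "perm_rank w i j \<le> perm_rank w d j + (i - d)"
        using perm_rank_le_add[of w d "i - d" j] i by simp
      moreover have "perm_rank w d j \<le> perm_rank u d j" using le ij by blast
      ultimately show ?thesis by simp
    next
      case False
      have *: "k \<le> i" if "k \<in> {1..n}" "u k \<le> j" for k
      proof (rule ccontr)
        assume "\<not> k \<le> i"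
        then have "u i < u k" using that i by (intro strict_mono_onD[OF hi]) auto
        then show False using that False by simp
      qed
      have "{k \<in> {1..n}. u k \<le> j} \<subseteq> {k \<in> {1..i}. u k \<le> j}" using * by auto
      then have "perm_rank u n j \<le> perm_rank u i j" unfolding perm_rank_def by (intro card_mono) auto
      moreover have "perm_rank w i j \<le> perm_rank w n j" using ij by (intro perm_rank_mono) auto
      ultimately show ?thesis using perm_rank_full[OF u, of j] perm_rank_full[OF w, of j] ij by simp
    qed
  qed
  then show "bruhat_le n u w" using bruhat_le_iff[OF u w] by blast
qed

text \<open>A violation \<open>p k < u k\<close> shows up at the bound \<open>p k\<close>, which
  \<open>k\<close> values of \<open>p\<close> but fewer than \<open>k\<close> values of
  \<open>u\<close> respect.\<close>

lemma sorted_dominance_iff: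
  fixes p u :: "nat \<Rightarrow> nat"
  assumes p: "strict_mono_on {1..d} p" "p ` {1..d} \<subseteq> {1..n}" and u: "strict_mono_on {1..d} u"
  shows "(\<forall>j\<in>{1..n}. perm_rank p d j \<le> perm_rank u d j) \<longleftrightarrow> (\<forall>k\<in>{1..d}. u k \<le> p k)"
proof
  assume le: "\<forall>j\<in>{1..n}. perm_rank p d j \<le> perm_rank u d j"
  show "\<forall>k\<in>{1..d}. u k \<le> p k"
  proof (rule ccontr)
    assume "\<not> (\<forall>k\<in>{1..d}. u k \<le> p k)"
    then obtain k where k: "k \<in> {1..d}" "p k < u k" by force
    have "{1..k} \<subseteq> {m \<in> {1..d}. p m \<le> p k}"
    proof
      fix m assume m: "m \<in> {1..k}"
      then have "p m \<le> p k"
        using strict_mono_onD[OF p(1), of m k] k(1) by (cases "m = k") auto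
      then show "m \<in> {m \<in> {1..d}. p m \<le> p k}" using m k by auto
    qed
    then have "card {1..k} \<le> perm_rank p d (p k)" unfolding perm_rank_def by (intro card_mono) auto
    moreover have "{m \<in> {1..d}. u m \<le> p k} \<subseteq> {1..<k}"
    proof
      fix m assume m: "m \<in> {m \<in> {1..d}. u m \<le> p k}"
      have "m < k"
      proof (rule ccontr)
        assume "\<not> m < k"
        then have "u k \<le> u m" using strict_mono_onD[OF u, of k m] k(1) m by (cases "m = k") auto
        then show False using k m by auto
      qed
      then show "m \<in> {1..<k}" using m by auto
    qed
    then have "perm_rank u d (p k) \<le> card {1..<k}" unfolding perm_rank_def by (intro card_mono) auto
    moreover have "p k \<in> {1..n}" using p(2) k by blast
    ultimately have "k \<le> k - 1" using le by (metis card_atLeastAtMost card_atLeastLessThan diff_Suc_1 One_nat_def le_trans)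
    then show False using k by auto
  qed
next
  assume *: "\<forall>k\<in>{1..d}. u k \<le> p k"
  show "\<forall>j\<in>{1..n}. perm_rank p d j \<le> perm_rank u d j"
  proof
    fix j
    have "{k \<in> {1..d}. p k \<le> j} \<subseteq> {k \<in> {1..d}. u k \<le> j}" using * by force
    then show "perm_rank p d j \<le> perm_rank u d j" unfolding perm_rank_def by (intro card_mono) auto
  qed
qed

lemma perm_rank_image_cong:
  assumes "inj_on p {1..d}" "inj_on w {1..d}" "p ` {1..d} = w ` {1..d}"
  shows "perm_rank p d j = perm_rank w d j"
proof -
  have "perm_rank f d j = card {x \<in> f ` {1..d}. x \<le> j}" if "inj_on f {1..d}" for f
  proof -
    have "{x \<in> f ` {1..d}. x \<le> j} = f ` {k \<in> {1..d}. f k \<le> j}" by auto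
    moreover have "inj_on f {k \<in> {1..d}. f k \<le> j}" by (rule inj_on_subset[OF that]) auto
    ultimately show ?thesis by (simp add: perm_rank_def card_image)
  qed
  then show ?thesis using assms by simp
qed

section \<open>Particles and tableaux\<close>

lemma part_antimono:
  assumes "is_partition lam" "1 \<le> i" "i \<le> j"
  shows "part lam j \<le> part lam i"
proof (cases "j \<le> length lam \<and> i < j")
  case True
  then have "lam ! (j - 1) \<le> lam ! (i - 1)"
    using assms unfolding is_partition_def by (intro sorted_wrt_nth_less[of "(\<ge>)"]) auto
  then show ?thesis using True assms by (simp add: part_def)
next
  case False
  then show ?thesis using assms by (cases "i = j") (auto simp: part_def)
qed

text \<open>\<open>p 1 < \<dots> < p d\<close> are the positions of \<open>d\<close> particles; the letter \<open>a\<close> moves a particle from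
  \<open>a\<close> to \<open>a + 1\<close> unless that position is occupied.\<close>

definition particle_move :: "nat \<Rightarrow> nat \<Rightarrow> (nat \<Rightarrow> nat) \<Rightarrow> nat \<Rightarrow> nat" where
  "particle_move d a p k = (if p k = a \<and> (k < d \<longrightarrow> p (Suc k) \<noteq> Suc a) then Suc a else p k)"

lemma strict_mono_on_gap:
  fixes p :: "nat \<Rightarrow> nat"
  assumes "strict_mono_on {1..d} p" "1 \<le> i" "i \<le> j" "j \<le> d"
  shows "p i + (j - i) \<le> p j"
  using assms(3,4)
proof (induction j rule: dec_induct)
  case (step j)
  then have "p j < p (Suc j)" using assms(2) by (intro strict_mono_onD[OF assms(1)]) auto
  then show ?case using step by simp
qed simp

lemma strict_mono_particle_move:
  assumes p: "strict_mono_on {1..d} p"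
  shows "strict_mono_on {1..d} (particle_move d a p)"
proof (rule strict_mono_onI)
  fix k l assume kl: "k \<in> {1..d}" "l \<in> {1..d}" "k < l"
  have lt: "p (Suc k) \<le> p l" "p k < p (Suc k)"
    using strict_mono_on_gap[OF p, of "Suc k" l] strict_mono_onD[OF p, of k "Suc k"] kl by auto
  then show "particle_move d a p k < particle_move d a p l"
    using kl by (auto simp: particle_move_def)
qed

text \<open>If \<open>a\<close> is in the set and \<open>Suc a\<close> is not, then \<open>a\<close>
  stands at a position up to \<open>d\<close> and \<open>Suc a\<close> later, so the step is carried
  out. If only \<open>Suc a\<close> is in the set, the order is reversed and the step is void. In
  the remaining cases exchanging the two values does not change the set.\<close>

lemma demazure_step_image:
  assumes w: "w permutes {1..n}" and a: "1 \<le> a" "a < n" and d: "d \<le> n"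
  shows "demazure_step a w ` {1..d} =
    (if a \<in> w ` {1..d} \<and> Suc a \<notin> w ` {1..d} then adj a ` w ` {1..d} else w ` {1..d})"
proof -
  have mem: "x \<in> w ` {1..d} \<longleftrightarrow> pinv w x \<le> d" if "x \<in> {1..n}" for x
  proof -
    have "1 \<le> pinv w x"
      using that permutes_in_image[OF permutes_inv[OF w], of x] by auto
    moreover have "x \<in> w ` {1..d} \<longleftrightarrow> pinv w x \<in> {1..d}"
      using permutes_inverses[OF w] by (metis image_iff)
    ultimately show ?thesis by simp
  qed
  have an: "a \<in> {1..n}" "Suc a \<in> {1..n}" using a by auto
  show ?thesis
  proof (cases "a \<in> w ` {1..d} \<longleftrightarrow> Suc a \<in> w ` {1..d}")
    case True
    then have "adj a ` w ` {1..d} = w ` {1..d}" by (rule transpose_image_eq)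
    then have "demazure_step a w ` {1..d} = w ` {1..d}"
      by (simp only: demazure_step_def image_comp split: if_split) blast
    then show ?thesis using True by (simp only: if_cancel split: if_split) blast
  next
    case False
    show ?thesis
    proof (cases "a \<in> w ` {1..d}")
      case True
      then have "pinv w a < pinv w (Suc a)" using False mem[OF an(1)] mem[OF an(2)] by linarith
      then show ?thesis using True False by (simp only: demazure_step_def image_comp if_True) simp
    next
      case nota: False
      then have "\<not> pinv w a < pinv w (Suc a)" using False mem[OF an(1)] mem[OF an(2)] by linarith
      then show ?thesis using nota by (simp only: demazure_step_def if_False) simp
    qed
  qed
qed

text \<open>If \<open>a\<close> and \<open>Suc a\<close> are both occupied, then by consecutive
  particles, so inspecting \<open>Suc k\<close> alone detects the blockage.\<close>

lemma particle_move_image: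
  assumes p: "strict_mono_on {1..d} p"
  shows "particle_move d a p ` {1..d} =
    (if a \<in> p ` {1..d} \<and> Suc a \<notin> p ` {1..d} then adj a ` p ` {1..d} else p ` {1..d})"
proof (cases "a \<in> p ` {1..d} \<and> Suc a \<notin> p ` {1..d}")
  case True
  have "particle_move d a p k = adj a (p k)" if "k \<in> {1..d}" for k
  proof -
    have "p k \<in> p ` {1..d}" using that by (rule imageI)
    then have "p k \<noteq> Suc a" using True by metis
    moreover have "p (Suc k) \<noteq> Suc a" if "k < d"
    proof -
      have "p (Suc k) \<in> p ` {1..d}" using that by (intro imageI) simp
      then show ?thesis using True by metis
    qed
    ultimately show ?thesis by (simp add: particle_move_def transpose_def)
  qed
  then have "particle_move d a p ` {1..d} = (\<lambda>k. adj a (p k)) ` {1..d}" by (rule image_cong[OF refl])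
  then show ?thesis unfolding if_P[OF True] image_image .
next
  case False
  have "particle_move d a p k = p k" if k: "k \<in> {1..d}" for k
  proof (cases "p k = a")
    case True
    then have "Suc a \<in> p ` {1..d}" using False k by blast
    then obtain l where l: "l \<in> {1..d}" "p l = Suc a" by force
    have "k < l"
    proof (rule ccontr)
      assume "\<not> k < l"
      then show False using strict_mono_on_gap[OF p, of l k] k l True by auto
    qed
    then have "p (Suc k) = Suc a" "k < d"
      using strict_mono_on_gap[OF p, of "Suc k" l] strict_mono_on_gap[OF p, of k "Suc k"] k l True by auto
    then show ?thesis by (simp add: particle_move_def)
  qed (simp add: particle_move_def)
  then have "particle_move d a p ` {1..d} = p ` {1..d}" by (rule image_cong[OF refl])
  then show ?thesis using False by (simp only: if_False)
qed

text \<open>A row is read with decreasing letters but multiplied from its right end, so the letters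
  act in increasing order and a particle may hop several times in one row. The bound
  \<open>b\<close> allows induction along the row.\<close>

definition particle_row :: "nat \<Rightarrow> (nat \<times> nat) set \<Rightarrow> nat \<Rightarrow> nat \<Rightarrow> (nat \<Rightarrow> nat) \<Rightarrow> nat \<Rightarrow> nat" where
  "particle_row d P r b p = fold (\<lambda>a p. if (r, a) \<in> P then particle_move d a p else p) [r..<b] p"

text \<open>The state after rows \<open>n, \<dots>, r\<close> have acted: the last row of the word
  acts first.\<close>

definition particles :: "nat \<Rightarrow> nat \<Rightarrow> (nat \<times> nat) set \<Rightarrow> nat \<Rightarrow> nat \<Rightarrow> nat" where
  "particles n d P r = foldr (\<lambda>r. particle_row d P r n) [r..<Suc n] id"

lemma particles_Suc: "r \<le> n \<Longrightarrow> particles n d P r = particle_row d P r n (particles n d P (Suc r))"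
  unfolding particles_def by (subst upt_conv_Cons) simp_all

lemma particles_end: "n < r \<Longrightarrow> particles n d P r = id"
  by (simp add: particles_def)

definition demazure_row :: "(nat \<times> nat) set \<Rightarrow> nat \<Rightarrow> nat list \<Rightarrow> (nat \<Rightarrow> nat) \<Rightarrow> nat \<Rightarrow> nat" where
  "demazure_row P r as w = fold (\<lambda>a w. if (r, a) \<in> P then demazure_step a w else w) as w"

lemma demazure_reading_word:
  "demazure (reading_word n P) = foldr (\<lambda>r. demazure_row P r [r..<n]) [1..<Suc n] id"
proof -
  have row: "foldr demazure_step (map snd (filter (\<lambda>p. p \<in> P) (map (Pair r) (rev as)))) w =
      demazure_row P r as w" for r as w
    by (induction as arbitrary: w) (simp_all add: demazure_row_def)
  have "foldr demazure_step (map snd (filter (\<lambda>p. p \<in> P)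
      (concat (map (\<lambda>r. map (Pair r) (rev [r..<n])) rs)))) id =
      foldr (\<lambda>r. demazure_row P r [r..<n]) rs id" for rs
    by (induction rs) (simp_all add: row)
  then show ?thesis by (simp only: demazure_def reading_word_def reading_def)
qed

lemma demazure_row_particles:
  fixes P r
  assumes "d \<le> n" "set as \<subseteq> {1..<n}"
    and "w permutes {1..n}" "strict_mono_on {1..d} p" "p ` {1..d} = w ` {1..d}"
  defines "q \<equiv> fold (\<lambda>a p. if (r, a) \<in> P then particle_move d a p else p) as p"
  shows "demazure_row P r as w permutes {1..n} \<and> strict_mono_on {1..d} q \<and>
    q ` {1..d} = demazure_row P r as w ` {1..d}"
  using assms(2-5) unfolding q_def
proof (induction as arbitrary: w p)
  case (Cons a as)
  then have a: "1 \<le> a" "a < n" and as: "set as \<subseteq> {1..<n}" by auto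
  show ?case
  proof (cases "(r, a) \<in> P")
    case True
    have "demazure_step a w permutes {1..n}"
      using permutes_comp_adj(2)[OF Cons.prems(2) a] Cons.prems(2) by (simp only: demazure_step_def split: if_split) blast
    moreover have "particle_move d a p ` {1..d} = demazure_step a w ` {1..d}"
      using demazure_step_image[OF Cons.prems(2) a assms(1)] particle_move_image[OF Cons.prems(3), of a] Cons.prems(4)
      by simp
    ultimately show ?thesis
      using Cons.IH[OF as _ strict_mono_particle_move[OF Cons.prems(3)]] True
      by (simp add: demazure_row_def)
  next
    case False
    then show ?thesis using Cons.IH[OF as Cons.prems(2-4)] by (simp add: demazure_row_def)
  qed
qed (simp add: demazure_row_def)

lemma demazure_particles:
  assumes "d \<le> n"
  shows "strict_mono_on {1..d} (particles n d P 1)"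
    and "particles n d P 1 ` {1..d} = demazure (reading_word n P) ` {1..d}"
    and "1 \<le> r \<Longrightarrow> strict_mono_on {1..d} (particles n d P r)"
proof -
  have *: "foldr (\<lambda>r. demazure_row P r [r..<n]) rs id permutes {1..n} \<and>
      strict_mono_on {1..d} (foldr (\<lambda>r. particle_row d P r n) rs id) \<and>
      foldr (\<lambda>r. particle_row d P r n) rs id ` {1..d} =
      foldr (\<lambda>r. demazure_row P r [r..<n]) rs id ` {1..d}" if "\<forall>r\<in>set rs. 1 \<le> r" for rs
    using that
  proof (induction rs)
    case Nil
    have "strict_mono_on {1..d} (\<lambda>a::nat. a)" by (simp add: strict_mono_on_def)
    then show ?case using permutes_id[of "{1..n}", unfolded id_def] by simp
  next
    case (Cons r rs)
    have letters: "set [r..<n] \<subseteq> {1..<n}" using Cons.prems by auto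
    have IH: "foldr (\<lambda>r. demazure_row P r [r..<n]) rs id permutes {1..n}"
      "strict_mono_on {1..d} (foldr (\<lambda>r. particle_row d P r n) rs id)"
      "foldr (\<lambda>r. particle_row d P r n) rs id ` {1..d} =
        foldr (\<lambda>r. demazure_row P r [r..<n]) rs id ` {1..d}"
      using Cons by (simp_all add: id_def)
    show ?case
      using demazure_row_particles[OF assms letters IH, where r = r and P = P]
      by (simp only: foldr_Cons o_apply id_def flip: particle_row_def)
  qed
  show "strict_mono_on {1..d} (particles n d P r)" if "1 \<le> r" for r
    unfolding particles_def by (rule *[THEN conjunct2, THEN conjunct1]) (use that in auto)
  then show "strict_mono_on {1..d} (particles n d P 1)" by simp
  show "particles n d P 1 ` {1..d} = demazure (reading_word n P) ` {1..d}"
    unfolding particles_def demazure_reading_word by (rule *[THEN conjunct2, THEN conjunct2]) auto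
qed

text \<open>A particle never reaches the position where its right neighbor began the row: it would
  need the letter just before that position, and at that time the neighbor, which waits for the next
  letter, is still there. This is the source of strictness in the columns of the tableau.\<close>

lemma particle_row_invariants:
  fixes P
  assumes p: "strict_mono_on {1..d} p" and "r \<le> b"
  defines "q \<equiv> \<lambda>b. particle_row d P r b p"
  shows "\<forall>k\<in>{1..d}. (q b k = p k \<or> q b k \<le> b) \<and> p k \<le> q b k \<and>
    (\<forall>x. p k \<le> x \<and> x < q b k \<longrightarrow> (r, x) \<in> P) \<and> (k < d \<longrightarrow> q b k < p (Suc k))"
  using assms(2)
proof (induction b rule: dec_induct)
  case base
  have "p k < p (Suc k)" if "k \<in> {1..d}" "k < d" for k
    using that by (intro strict_mono_onD[OF p]) auto
  then show ?case by (auto simp: q_def particle_row_def)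
next
  case (step b)
  have q: "q (Suc b) = (if (r, b) \<in> P then particle_move d b (q b) else q b)"
    using step.hyps by (simp add: q_def particle_row_def)
  show ?case
  proof
    fix k assume k: "k \<in> {1..d}"
    have IH: "q b k = p k \<or> q b k \<le> b" "p k \<le> q b k"
      "\<And>x. p k \<le> x \<Longrightarrow> x < q b k \<Longrightarrow> (r, x) \<in> P" "k < d \<Longrightarrow> q b k < p (Suc k)"
      using step.IH k by blast+
    have IH': "q b (Suc k) = p (Suc k) \<or> q b (Suc k) \<le> b" "p (Suc k) \<le> q b (Suc k)" if "k < d"
    proof -
      have "Suc k \<in> {1..d}" using that by simp
      then show "q b (Suc k) = p (Suc k) \<or> q b (Suc k) \<le> b" "p (Suc k) \<le> q b (Suc k)"
        using step.IH by blast+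
    qed
    show "(q (Suc b) k = p k \<or> q (Suc b) k \<le> Suc b) \<and> p k \<le> q (Suc b) k \<and>
      (\<forall>x. p k \<le> x \<and> x < q (Suc b) k \<longrightarrow> (r, x) \<in> P) \<and> (k < d \<longrightarrow> q (Suc b) k < p (Suc k))"
    proof (cases "(r, b) \<in> P \<and> q b k = b \<and> (k < d \<longrightarrow> q b (Suc k) \<noteq> Suc b)")
      case True
      then have new: "q (Suc b) k = Suc b" by (simp add: q particle_move_def)
      have "Suc b < p (Suc k)" if "k < d"
        using IH'[OF that] IH(4)[OF that] True that by auto
      moreover have "(r, x) \<in> P" if "p k \<le> x" "x < Suc b" for x
        using IH(3)[of x] that True by (cases "x = b") auto
      ultimately show ?thesis using IH(2) True by (simp add: new)
    next
      case False
      then have "q (Suc b) k = q b k" by (auto simp: q particle_move_def)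
      then show ?thesis using IH by auto
    qed
  qed
qed

text \<open>Only a missing cross or the right neighbor can stop a particle. The target is capped by
  \<open>b\<close> because the letters below \<open>b\<close> cannot take a moving particle beyond
  \<open>b\<close>.\<close>

lemma particle_row_reaches:
  assumes p: "strict_mono_on {1..d} p" and "r \<le> b" and P: "P \<subseteq> staircase n" and k: "k \<in> {1..d}"
    and t: "k < d \<Longrightarrow> t < p (Suc k)" "\<And>x. p k \<le> x \<Longrightarrow> x < t \<Longrightarrow> (r, x) \<in> P"
  shows "min t b \<le> particle_row d P r b p k"
  using assms(2)
proof (induction b rule: dec_induct)
  \<comment> \<open>In the staircase a cross of row \<open>r\<close> has index at least
    \<open>r\<close>, so a particle with somewhere to go already stands at \<open>r\<close> or
    beyond.\<close>
  case base
  have "min t r \<le> p k"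
  proof (cases "t \<le> p k")
    case False
    then have "(r, p k) \<in> P" using t(2)[of "p k"] by simp
    then show ?thesis using P by (auto simp: staircase_def)
  qed simp
  then show ?case by (simp add: particle_row_def)
next
  case (step b)
  let ?q = "particle_row d P r b p"
  have q: "particle_row d P r (Suc b) p = (if (r, b) \<in> P then particle_move d b ?q else ?q)"
    using step.hyps by (simp add: particle_row_def)
  have ge: "?q k \<le> particle_row d P r (Suc b) p k"
    by (auto simp: q particle_move_def)
  show ?case
  proof (cases "Suc b \<le> ?q k \<or> t \<le> ?q k")
    case True
    then show ?thesis using ge by auto
  next
    case False
    then have eq: "?q k = b" "b < t" using step.IH by auto
    have "p k \<le> ?q k" using particle_row_invariants[OF p step.hyps(1), of P] k by blast
    then have "p k \<le> b" using eq(1) by simp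
    then have "(r, b) \<in> P" using t(2) eq(2) by blast
    moreover have "?q (Suc k) \<noteq> Suc b" if "k < d"
    proof -
      have "Suc k \<in> {1..d}" using that by simp
      then have "p (Suc k) \<le> ?q (Suc k)" using particle_row_invariants[OF p step.hyps(1), of P] by blast
      then show ?thesis using t(1)[OF that] eq(2) by simp
    qed
    ultimately show ?thesis using eq by (simp add: q particle_move_def)
  qed
qed

lemma particles_row:
  assumes P: "P \<subseteq> staircase n" and "d \<le> n" and r: "1 \<le> r" "r \<le> n" and k: "k \<in> {1..d}"
  defines "p \<equiv> particles n d P"
  shows "p (Suc r) k \<le> p r k"
    and "p (Suc r) k \<le> x \<Longrightarrow> x < p r k \<Longrightarrow> (r, x) \<in> P"
    and "k < d \<Longrightarrow> p r k < p (Suc r) (Suc k)"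
    and "(k < d \<Longrightarrow> t < p (Suc r) (Suc k)) \<Longrightarrow>
      (\<And>x. p (Suc r) k \<le> x \<Longrightarrow> x < t \<Longrightarrow> (r, x) \<in> P) \<Longrightarrow> t \<le> p r k"
proof -
  have mono: "strict_mono_on {1..d} (p (Suc r))"
    unfolding p_def by (rule demazure_particles(3)[OF assms(2)]) simp
  have row: "p r = particle_row d P r n (p (Suc r))"
    unfolding p_def by (rule particles_Suc[OF r(2)])
  note inv = particle_row_invariants[OF mono r(2), of P, folded row, THEN bspec, OF k]
  show le: "p (Suc r) k \<le> p r k" "p (Suc r) k \<le> x \<Longrightarrow> x < p r k \<Longrightarrow> (r, x) \<in> P"
    "k < d \<Longrightarrow> p r k < p (Suc r) (Suc k)" using inv by blast+
  assume t: "k < d \<Longrightarrow> t < p (Suc r) (Suc k)" "\<And>x. p (Suc r) k \<le> x \<Longrightarrow> x < t \<Longrightarrow> (r, x) \<in> P"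
  show "t \<le> p r k"
  proof (cases "t \<le> p (Suc r) k")
    case False
    \<comment> \<open>\<open>particle_row_reaches\<close> yields only \<open>min t n\<close>; the
      last cross before \<open>t\<close> has index below \<open>n\<close>.\<close>
    then have "(r, t - 1) \<in> P" using t(2)[of "t - 1"] by simp
    then have "t \<le> n" using P by (auto simp: staircase_def)
    then show ?thesis
      using particle_row_reaches[OF mono r(2) P k t, folded row] by simp
  qed (use le in simp)
qed

lemma particles_ge:
  assumes "P \<subseteq> staircase n" "d \<le> n" "1 \<le> r" "k \<in> {1..d}"
  shows "k \<le> particles n d P r k"
proof -
  have mono: "strict_mono_on {1..d} (particles n d P r)" by (rule demazure_particles(3)[OF assms(2,3)])
  have "1 \<le> particles n d P r 1"
  proof (cases "r \<le> n")
    case True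
    then show ?thesis using \<open>1 \<le> r\<close>
    proof (induction r rule: inc_induct)
      case base
      then show ?case using particles_row(1)[OF assms(1,2), of n 1] assms(3,4) by (auto simp: particles_end)
    next
      case (step r)
      then show ?case using particles_row(1)[OF assms(1,2), of r 1] assms(3,4) by auto
    qed
  qed (simp add: particles_end)
  then show ?thesis using strict_mono_on_gap[OF mono, of 1 k] assms(4) by auto
qed

text \<open>Before row \<open>d\<close> acts nothing moves, as crosses in rows beyond
  \<open>d\<close> have indices beyond \<open>d\<close>. This bounds the tableau entries by
  \<open>d\<close>.\<close>

lemma particles_above:
  assumes "P \<subseteq> staircase n" "d \<le> n" "d < r" "k \<in> {1..d}"
  shows "particles n d P r k = k"
proof (cases "r \<le> Suc n")
  case True
  then show ?thesis using \<open>d < r\<close>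
  proof (induction r rule: inc_induct)
    case base
    then show ?case by (simp add: particles_end)
  next
    case (step r)
    then have eq: "particles n d P (Suc r) k = k" by simp
    have r: "1 \<le> r" "r \<le> n" using step by auto
    have "\<not> k < particles n d P r k"
    proof
      assume "k < particles n d P r k"
      then have "(r, k) \<in> P" using particles_row(2)[OF assms(1,2) r assms(4), of k] eq by simp
      then show False using assms(1,4) step.prems by (auto simp: staircase_def)
    qed
    then show ?case using particles_row(1)[OF assms(1,2) r assms(4)] eq by simp
  qed
qed (simp add: particles_end)

section \<open>Translation between particle trajectories and tableaux\<close>

definition tableau_crosses :: "nat list \<Rightarrow> nat \<Rightarrow> (nat \<times> nat \<Rightarrow> nat) \<Rightarrow> (nat \<times> nat) set" where
  "tableau_crosses lam d T = (\<lambda>(a, b). (T (a, b), a + b - 1)) ` cells lam d"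

lemma particles_tableau:
  assumes P: "P \<subseteq> staircase n" and d: "d \<le> n"
    and reach: "\<And>k. k \<in> {1..d} \<Longrightarrow> part lam (d - k + 1) + k \<le> particles n d P 1 k"
  shows "\<exists>T. color_tableau lam d T \<and> tableau_crosses lam d T \<subseteq> P"
proof -
  let ?p = "particles n d P"
  \<comment> \<open>Rows act in decreasing order, so the largest element of \<open>R k b\<close> is
    the row in which particle \<open>k\<close> first gets to \<open>k + b\<close>, using the cross
    of index \<open>k + b - 1\<close>.\<close>
  define R where "R k b = {r \<in> {1..n}. k + b \<le> ?p r k}" for k b
  define T where "T = (\<lambda>(k, b). if (k, b) \<in> cells lam d then Max (R k b) else 0)"
  have cell: "k \<in> {1..d}" "1 \<le> b" if "(k, b) \<in> cells lam d" for k b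
    using that by (auto simp: cells_def)
  have R: "finite (R k b)" "R k b \<noteq> {}" if c: "(k, b) \<in> cells lam d" for k b
  proof -
    have "1 \<in> R k b" using reach[OF cell(1)[OF c]] c d by (auto simp: R_def cells_def)
    then show "R k b \<noteq> {}" by blast
  qed (simp add: R_def)
  have TR: "T (k, b) \<in> R k b" if c: "(k, b) \<in> cells lam d" for k b
    using Max_in[OF R[OF c]] c by (simp add: T_def)
  have T_ge: "r \<le> T (k, b)" if c: "(k, b) \<in> cells lam d" and "r \<in> R k b" for k b r
    using Max_ge[OF R(1)[OF c] that(2)] c by (simp add: T_def)
  have T_less: "?p (Suc (T (k, b))) k < k + b" if c: "(k, b) \<in> cells lam d" for k b
  proof (cases "Suc (T (k, b)) \<le> n")
    case True
    then have "Suc (T (k, b)) \<notin> R k b" using T_ge[OF c, of "Suc (T (k, b))"] by auto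
    then show ?thesis using True by (auto simp: R_def)
  qed (use cell[OF c] in \<open>simp add: particles_end\<close>)
  have T_le: "T (k, b) \<le> d" if c: "(k, b) \<in> cells lam d" for k b
  proof (rule ccontr)
    assume "\<not> T (k, b) \<le> d"
    then have "?p (T (k, b)) k = k" using particles_above[OF P d _ cell(1)[OF c]] by simp
    then show False using TR[OF c] cell[OF c] by (auto simp: R_def)
  qed
  have "color_tableau lam d T"
    unfolding color_tableau_def
  proof (intro conjI allI impI ballI)
    fix x assume "x \<in> cells lam d"
    then show "T x \<in> {1..d}" using TR T_le by (cases x) (auto simp: R_def)
  next
    fix a b b' assume c: "(a, b) \<in> cells lam d \<and> (a, b') \<in> cells lam d \<and> b < b'"
    then have "T (a, b') \<in> R a b" using TR[of a b'] by (auto simp: R_def)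
    then show "T (a, b') \<le> T (a, b)" using T_ge c by blast
  next
    fix a a' b assume c: "(a, b) \<in> cells lam d \<and> (a', b) \<in> cells lam d \<and> a < a'"
    let ?r = "T (a, b)"
    have r: "1 \<le> ?r" "?r \<le> n" "a + b \<le> ?p ?r a" using TR[of a b] c by (auto simp: R_def)
    have ad: "a \<in> {1..d}" "a < d" "a' \<in> {1..d}" using cell c by force+
    \<comment> \<open>When particle \<open>a\<close> reaches \<open>a + b\<close> in row
      \<open>?r\<close>, its right neighbor was beyond \<open>a + b\<close> before that row acted,
      and particle \<open>a'\<close> is further right by at least the difference of indices. Its
      entry is therefore larger.\<close>
    have "?p ?r a < ?p (Suc ?r) (Suc a)" using particles_row(3)[OF P d r(1,2) ad(1,2)] .
    moreover have "?p (Suc ?r) (Suc a) + (a' - Suc a) \<le> ?p (Suc ?r) a'"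
      using ad c by (intro strict_mono_on_gap[OF demazure_particles(3)[OF d]]) auto
    moreover have "a < a'" using c by blast
    ultimately have far: "a' + b \<le> ?p (Suc ?r) a'" using r(3) by linarith
    have "Suc ?r \<le> n"
    proof (rule ccontr)
      assume "\<not> Suc ?r \<le> n"
      then show False using far cell(2)[of a b] c by (simp add: particles_end)
    qed
    then have "Suc ?r \<in> R a' b" using far by (simp add: R_def)
    then show "T (a, b) < T (a', b)" using T_ge[of a' b "Suc ?r"] c by simp
  qed (auto simp: T_def)
  moreover have "tableau_crosses lam d T \<subseteq> P"
  proof -
    have "(T (k, b), k + b - 1) \<in> P" if c: "(k, b) \<in> cells lam d" for k b
    proof -
      have "1 \<le> T (k, b)" "T (k, b) \<le> n" "k + b \<le> ?p (T (k, b)) k" using TR[OF c] by (auto simp: R_def)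
      then show ?thesis
        using particles_row(2)[OF P d _ _ cell(1)[OF c], of "T (k, b)" "k + b - 1"] T_less[OF c] cell(2)[OF c]
        by simp
    qed
    then show ?thesis by (auto simp: tableau_crosses_def)
  qed
  ultimately show ?thesis by blast
qed

lemma tableau_particles:
  assumes P: "P \<subseteq> staircase n" and d: "d \<le> n" and lam: "is_partition lam"
    and T: "color_tableau lam d T" "tableau_crosses lam d T \<subseteq> P" and k: "k \<in> {1..d}"
  shows "part lam (d - k + 1) + k \<le> particles n d P 1 k"
proof -
  let ?p = "particles n d P"
  \<comment> \<open>The invariant after rows \<open>n, \<dots>, r\<close>: particle \<open>k\<close>
    has passed every cell of row \<open>k\<close> whose entry is at least \<open>r\<close>.\<close>
  have reach: "\<forall>k b. (k, b) \<in> cells lam d \<longrightarrow> r \<le> T (k, b) \<longrightarrow> k + b \<le> ?p r k"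
    if "1 \<le> r" "r \<le> Suc n" for r
    using that(2,1)
  proof (induction r rule: inc_induct)
    case base
    have "T x \<le> d" if "x \<in> cells lam d" for x using T(1) that by (auto simp: color_tableau_def)
    then show ?case using d by fastforce
  next
    case (step r)
    have r: "1 \<le> r" "r \<le> n" using step by auto
    have IH: "k + b \<le> ?p (Suc r) k" if "(k, b) \<in> cells lam d" "Suc r \<le> T (k, b)" for k b
      using step.IH that by simp
    show ?case
    proof (intro allI impI)
      fix k b assume c: "(k, b) \<in> cells lam d" and rT: "r \<le> T (k, b)"
      then have k: "k \<in> {1..d}" and b: "1 \<le> b" "b \<le> part lam (d - k + 1)" by (auto simp: cells_def)
      show "k + b \<le> ?p r k"
      proof (rule particles_row(4)[OF P d r k])
        assume "k < d"
        then have "part lam (d - k + 1) \<le> part lam (d - Suc k + 1)"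
          by (intro part_antimono[OF lam]) auto
        then have c': "(Suc k, b) \<in> cells lam d" using b \<open>k < d\<close> by (auto simp: cells_def)
        then have "T (k, b) < T (Suc k, b)" using T(1) c unfolding color_tableau_def by blast
        then show "k + b < ?p (Suc r) (Suc k)" using IH[OF c'] rT by simp
      next
        fix x assume x: "?p (Suc r) k \<le> x" "x < k + b"
        have "k \<le> x" using particles_ge[OF P d, of "Suc r" k] k x by simp
        \<comment> \<open>The index \<open>x\<close> belongs to the cell \<open>(k, b')\<close>. Its
          entry is at least \<open>r\<close> by weak decrease along the row, and not larger, since
          otherwise the particle would be beyond \<open>x\<close> before row \<open>r\<close> acts.
          Hence \<open>(r, x)\<close> is the cross of this cell.\<close>
        define b' where "b' = x - k + 1"
        have b': "b' \<le> b" "x = k + b' - 1" "1 \<le> b'" using x \<open>k \<le> x\<close> by (auto simp: b'_def)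
        then have c': "(k, b') \<in> cells lam d" using b k by (auto simp: cells_def)
        have "T (k, b) \<le> T (k, b')"
        proof (cases "b' = b")
          case False
          then show ?thesis using T(1) c c' b'(1) unfolding color_tableau_def by (metis le_neq_implies_less)
        qed simp
        moreover have "\<not> Suc r \<le> T (k, b')" using IH[OF c'] x b' by auto
        ultimately have "T (k, b') = r" using rT by simp
        then have "(r, x) \<in> tableau_crosses lam d T" using c' b' by (force simp: tableau_crosses_def)
        then show "(r, x) \<in> P" using T(2) by blast
      qed
    qed
  qed
  show ?thesis
  proof (cases "part lam (d - k + 1) = 0")
    case True
    then show ?thesis using particles_ge[OF P d, of 1 k] k by simp
  next
    case False
    then have c: "(k, part lam (d - k + 1)) \<in> cells lam d" using k by (auto simp: cells_def)
    then have "1 \<le> T (k, part lam (d - k + 1))" using T(1) by (auto simp: color_tableau_def)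
    then show ?thesis using reach[of 1] c by (simp add: add.commute)
  qed
qed

lemma grass_perm_props:
  assumes lam: "is_partition lam" and n: "part lam 1 + d \<le> n"
  shows "grass_perm n lam d permutes {1..n}"
    "\<And>k. k \<in> {1..d} \<Longrightarrow> grass_perm n lam d k = part lam (d - k + 1) + k"
    "strict_mono_on {1..d} (grass_perm n lam d)" "strict_mono_on {d + 1..n} (grass_perm n lam d)"
proof -
  define g where "g k = part lam (d - k + 1) + k" for k
  have mono: "strict_mono_on {1..d} g"
  proof (rule strict_mono_onI)
    fix k l assume "k \<in> {1..d}" "l \<in> {1..d}" "k < l"
    then have "part lam (d - k + 1) \<le> part lam (d - l + 1)"
      by (intro part_antimono[OF lam]) auto
    then show "g k < g l" using \<open>k < l\<close> by (simp add: g_def)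
  qed
  moreover have "g ` {1..d} \<subseteq> {1..n}"
  proof
    fix x assume "x \<in> g ` {1..d}"
    then obtain k where k: "k \<in> {1..d}" "x = g k" by blast
    then have "part lam (d - k + 1) \<le> part lam 1" by (intro part_antimono[OF lam]) auto
    then show "x \<in> {1..n}" using n k by (auto simp: g_def)
  qed
  ultimately have "\<exists>!u. u permutes {1..n} \<and> (\<forall>k\<in>{1..d}. u k = g k) \<and> strict_mono_on {d + 1..n} u"
    by (rule grass_perm_exists)
  then have u: "grass_perm n lam d permutes {1..n} \<and> (\<forall>k\<in>{1..d}. grass_perm n lam d k = g k) \<and>
      strict_mono_on {d + 1..n} (grass_perm n lam d)"
    unfolding grass_perm_def g_def by (rule theI')
  then show "grass_perm n lam d permutes {1..n}" "strict_mono_on {d + 1..n} (grass_perm n lam d)"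
    "\<And>k. k \<in> {1..d} \<Longrightarrow> grass_perm n lam d k = part lam (d - k + 1) + k"
    by (auto simp: g_def)
  show "strict_mono_on {1..d} (grass_perm n lam d)"
    using mono u by (simp add: strict_mono_on_def)
qed

theorem grass_perm_le_demazure_iff:
  assumes lam: "is_partition lam" and n: "part lam 1 + d \<le> n" and P: "P \<subseteq> staircase n"
  shows "bruhat_le n (grass_perm n lam d) (demazure (reading_word n P)) \<longleftrightarrow>
    (\<exists>T. color_tableau lam d T \<and> tableau_crosses lam d T \<subseteq> P)"
proof -
  note u = grass_perm_props[OF lam n]
  have d: "d \<le> n" using n by simp
  have w: "demazure (reading_word n P) permutes {1..n}" by (rule demazure_permutes[OF set_reading_word])
  note p = demazure_particles(1,2)[OF d, of P]
  have "demazure (reading_word n P) ` {1..d} \<subseteq> demazure (reading_word n P) ` {1..n}"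
    using d by (intro image_mono) auto
  then have range: "particles n d P 1 ` {1..d} \<subseteq> {1..n}" using p(2) permutes_image[OF w] by simp
  have rank: "perm_rank (particles n d P 1) d j = perm_rank (demazure (reading_word n P)) d j" for j
    by (rule perm_rank_image_cong[OF strict_mono_on_imp_inj_on[OF p(1)] permutes_inj_on[OF w] p(2)])
  have "bruhat_le n (grass_perm n lam d) (demazure (reading_word n P)) \<longleftrightarrow>
      (\<forall>k\<in>{1..d}. grass_perm n lam d k \<le> particles n d P 1 k)"
    using bruhat_le_grassmannian[OF u(1) w d u(3,4)] sorted_dominance_iff[OF p(1) range u(3)] by (simp only: rank)
  also have "\<dots> \<longleftrightarrow> (\<forall>k\<in>{1..d}. part lam (d - k + 1) + k \<le> particles n d P 1 k)"
    by (simp only: u(2) cong: ball_cong)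
  also have "\<dots> \<longleftrightarrow> (\<exists>T. color_tableau lam d T \<and> tableau_crosses lam d T \<subseteq> P)"
    using particles_tableau[OF P d, of lam] tableau_particles[OF P d lam] by metis
  finally show ?thesis .
qed

section \<open>Tableaux of one color with crosses in a fixed set\<close>

lemma color_tableau_outside: "color_tableau lam d T \<Longrightarrow> x \<notin> cells lam d \<Longrightarrow> T x = 0"
  unfolding color_tableau_def by blast

lemma color_tableau_column_gap:
  assumes T: "color_tableau lam d T" and lam: "is_partition lam" and c: "(a, b) \<in> cells lam d"
    and a': "a \<le> a'" "a' \<le> d"
  shows "T (a, b) + (a' - a) \<le> T (a', b)"
  using a'
proof (induction a' rule: dec_induct)
  case (step a')
  have cell: "(e, b) \<in> cells lam d" if "a \<le> e" "e \<le> d" for e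
  proof -
    have "part lam (d - a + 1) \<le> part lam (d - e + 1)"
      using that by (intro part_antimono[OF lam]) auto
    then show ?thesis using c that by (auto simp: cells_def)
  qed
  have "(a', b) \<in> cells lam d" "(Suc a', b) \<in> cells lam d" using cell[of a'] cell[of "Suc a'"] step by auto
  then have "T (a', b) < T (Suc a', b)" using T unfolding color_tableau_def by blast
  then show ?case using step by simp
qed simp

lemma tableau_crosses_subset_staircase:
  assumes T: "color_tableau lam d T" and lam: "is_partition lam" and n: "part lam 1 + d \<le> n"
  shows "tableau_crosses lam d T \<subseteq> staircase n"
proof -
  have "(T (a, b), a + b - 1) \<in> staircase n" if c: "(a, b) \<in> cells lam d" for a b
  proof -
    have ab: "1 \<le> a" "a \<le> d" "1 \<le> b" "b \<le> part lam (d - a + 1)" using c by (auto simp: cells_def)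
    have "part lam (d - a + 1) \<le> part lam 1" using ab by (intro part_antimono[OF lam]) auto
    \<comment> \<open>Strict increase down to row \<open>d\<close>, where entries are at most
      \<open>d\<close>, forces \<open>T (a, b) \<le> a \<le> a + b - 1\<close>.\<close>
    moreover have "T (a, b) + (d - a) \<le> T (d, b)"
      using color_tableau_column_gap[OF T lam c, of d] ab by simp
    moreover have "T (d, b) \<le> d"
    proof (cases "(d, b) \<in> cells lam d")
      case True
      then show ?thesis using T by (auto simp: color_tableau_def)
    next
      case False
      then show ?thesis using T by (simp add: color_tableau_def)
    qed
    moreover have "1 \<le> T (a, b)" using T c by (auto simp: color_tableau_def)
    ultimately show ?thesis using ab n by (auto simp: staircase_def)
  qed
  then show ?thesis by (auto simp: tableau_crosses_def)
qed

text \<open>From the upper cell go left to the column of the lower one, where the entry does not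
  drop, and then down, where it rises. So when an entry is raised, only another color can still hold
  its old cross.\<close>

lemma color_tableau_antidiagonal_inj:
  assumes T: "color_tableau lam d T" and x: "x \<in> cells lam d" and y: "y \<in> cells lam d"
    and s: "fst x + snd x = fst y + snd y" and eq: "T x = T y"
  shows "x = y"
proof -
  have no: "\<not> fst x < fst y" if x: "x \<in> cells lam d" and y: "y \<in> cells lam d"
    and s: "fst x + snd x = fst y + snd y" and eq: "T x = T y" for x y
  proof
    assume lt: "fst x < fst y"
    obtain a b a' b' where [simp]: "x = (a, b)" "y = (a', b')" by fastforce
    have c: "(a, b') \<in> cells lam d" "b' < b" using x y s lt by (auto simp: cells_def)
    have "T (a, b) \<le> T (a, b')" using T c x unfolding color_tableau_def by auto
    also have "T (a, b') < T (a', b')" using T c(1) y lt unfolding color_tableau_def by auto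
    finally show False using eq by simp
  qed
  have "fst x = fst y" using no[OF x y s eq] no[OF y x s[symmetric] eq[symmetric]] by simp
  then show ?thesis using s by (simp add: prod_eq_iff)
qed

lemma color_tableau_row_index: "color_tableau lam d (\<lambda>x. if x \<in> cells lam d then fst x else 0)"
  by (auto simp: color_tableau_def cells_def)

text \<open>The tableaux with crosses in a fixed set are closed under entrywise maximum.\<close>

lemma greatest_tableau:
  assumes "color_tableau lam d t0" "tableau_crosses lam d t0 \<subseteq> P"
  shows "\<exists>M. color_tableau lam d M \<and> tableau_crosses lam d M \<subseteq> P \<and>
    (\<forall>t x. color_tableau lam d t \<longrightarrow> tableau_crosses lam d t \<subseteq> P \<longrightarrow> t x \<le> M x)"
proof -
  define TT where "TT = {t. color_tableau lam d t \<and> tableau_crosses lam d t \<subseteq> P}"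
  define M where "M = (\<lambda>x. if x \<in> cells lam d then Max ((\<lambda>t. t x) ` TT) else 0)"
  have fin: "finite ((\<lambda>t. t x) ` TT)" if "x \<in> cells lam d" for x
    by (rule finite_subset[of _ "{1..d}"]) (use that in \<open>auto simp: TT_def color_tableau_def\<close>)
  have ne: "TT \<noteq> {}" using assms by (auto simp: TT_def)
  have le: "t x \<le> M x" if t: "t \<in> TT" for t x
  proof (cases "x \<in> cells lam d")
    case True
    then show ?thesis using Max_ge[OF fin[OF True]] t by (simp add: M_def)
  next
    case False
    then show ?thesis using t color_tableau_outside[of lam d t x] by (simp add: TT_def)
  qed
  have att: "\<exists>t\<in>TT. M x = t x" if x: "x \<in> cells lam d" for x
  proof -
    have "Max ((\<lambda>t. t x) ` TT) \<in> (\<lambda>t. t x) ` TT" using fin[OF x] ne by (intro Max_in) simp_all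
    then show ?thesis using x by (auto simp: M_def)
  qed
  have "color_tableau lam d M"
    unfolding color_tableau_def
  proof (intro conjI allI impI ballI)
    fix x assume x: "x \<in> cells lam d"
    then obtain t where "t \<in> TT" "M x = t x" using att by blast
    then show "M x \<in> {1..d}" using x by (auto simp: TT_def color_tableau_def)
  next
    fix a b b' assume c: "(a, b) \<in> cells lam d \<and> (a, b') \<in> cells lam d \<and> b < b'"
    then obtain t where t: "t \<in> TT" "M (a, b') = t (a, b')" using att by blast
    then have "t (a, b') \<le> t (a, b)" using c unfolding TT_def color_tableau_def by blast
    then show "M (a, b') \<le> M (a, b)" using le[OF t(1), of "(a, b)"] t(2) by simp
  next
    fix a a' b assume c: "(a, b) \<in> cells lam d \<and> (a', b) \<in> cells lam d \<and> a < a'"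
    then obtain t where t: "t \<in> TT" "M (a, b) = t (a, b)" using att by blast
    then have "t (a, b) < t (a', b)" using c unfolding TT_def color_tableau_def by blast
    then show "M (a, b) < M (a', b)" using le[OF t(1), of "(a', b)"] t(2) by simp
  qed (simp add: M_def)
  moreover have "tableau_crosses lam d M \<subseteq> P"
  proof
    fix y assume "y \<in> tableau_crosses lam d M"
    then obtain a b where ab: "(a, b) \<in> cells lam d" "y = (M (a, b), a + b - 1)"
      by (auto simp: tableau_crosses_def)
    then obtain t where t: "t \<in> TT" "M (a, b) = t (a, b)" using att by blast
    then have "y \<in> tableau_crosses lam d t" using ab by (force simp: tableau_crosses_def)
    then show "y \<in> P" using t(1) by (auto simp: TT_def)
  qed
  ultimately show ?thesis using le by (auto simp: TT_def)
qed

lemma raise_tableau_entry: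
  assumes t: "color_tableau lam d t" and M: "color_tableau lam d M"
    and le: "\<And>x. t x \<le> M x" and neq: "t \<noteq> M"
  shows "\<exists>x\<in>cells lam d. t x < M x \<and> color_tableau lam d (t(x := M x))"
proof -
  define D where "D = {x \<in> cells lam d. t x \<noteq> M x}"
  obtain x0 where "t x0 \<noteq> M x0" using neq by (meson ext)
  moreover from this have "x0 \<in> cells lam d"
    using color_tableau_outside[OF t, of x0] color_tableau_outside[OF M, of x0] by metis
  ultimately have "x0 \<in> D" by (simp add: D_def)
  \<comment> \<open>Minimizing \<open>snd y + (d - fst y)\<close> picks a cell that no differing
    cell precedes to its left or below. There \<open>t\<close> agrees with \<open>M\<close>, so the
    raised entry obeys the upper bounds of \<open>M\<close>; the neighbors to its right and above
    only gain room.\<close>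
  then obtain x where x: "x \<in> D" and least: "\<And>y. y \<in> D \<Longrightarrow> snd x + (d - fst x) \<le> snd y + (d - fst y)"
    using ex_has_least_nat[of "\<lambda>y. y \<in> D" x0 "\<lambda>y. snd y + (d - fst y)"] by blast
  obtain a b where ab: "x = (a, b)" by fastforce
  have cab: "(a, b) \<in> cells lam d" using x by (simp add: D_def ab)
  have left: "t (a, b') = M (a, b')" if "(a, b') \<in> cells lam d" "b' < b" for b'
    using least[of "(a, b')"] that by (auto simp: D_def ab)
  have below: "t (a', b) = M (a', b)" if "(a', b) \<in> cells lam d" "a < a'" for a'
  proof (rule ccontr)
    assume "t (a', b) \<noteq> M (a', b)"
    then have "(a', b) \<in> D" using that by (simp add: D_def)
    then have "b + (d - a) \<le> b + (d - a')" using least[of "(a', b)"] by (simp add: ab)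
    moreover have "a' \<le> d" using that by (simp add: cells_def)
    ultimately show False using that(2) by linarith
  qed
  have tr: "t (e, f') \<le> t (e, f)" if "(e, f) \<in> cells lam d" "(e, f') \<in> cells lam d" "f < f'" for e f f'
    using t that unfolding color_tableau_def by blast
  have Mr: "M (e, f') \<le> M (e, f)" if "(e, f) \<in> cells lam d" "(e, f') \<in> cells lam d" "f < f'" for e f f'
    using M that unfolding color_tableau_def by blast
  have tc: "t (e, f) < t (e', f)" if "(e, f) \<in> cells lam d" "(e', f) \<in> cells lam d" "e < e'" for e e' f
    using t that unfolding color_tableau_def by blast
  have Mc: "M (e, f) < M (e', f)" if "(e, f) \<in> cells lam d" "(e', f) \<in> cells lam d" "e < e'" for e e' f
    using M that unfolding color_tableau_def by blast
  have lex: "t (a, b) \<le> M (a, b)" by (rule le)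
  let ?t = "t((a, b) := M (a, b))"
  have "color_tableau lam d ?t"
    unfolding color_tableau_def
  proof (intro conjI allI impI ballI)
    fix y assume "y \<in> cells lam d"
    then show "?t y \<in> {1..d}" using t M by (auto simp: color_tableau_def)
  next
    fix y assume "y \<notin> cells lam d"
    then show "?t y = 0" using color_tableau_outside[OF t, of y] cab by auto
  next
    fix e f f' assume c: "(e, f) \<in> cells lam d \<and> (e, f') \<in> cells lam d \<and> f < f'"
    consider "e = a \<and> f = b" | "e = a \<and> f' = b" | "(e, f) \<noteq> (a, b)" "(e, f') \<noteq> (a, b)" by blast
    then show "?t (e, f') \<le> ?t (e, f)"
    proof cases
      case 1
      then show ?thesis using c tr[of a b f'] lex by auto
    next
      case 2
      then show ?thesis using c Mr[of a f b] left[of f] by auto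
    next
      case 3
      then show ?thesis using c tr[of e f f'] by auto
    qed
  next
    fix e e' f assume c: "(e, f) \<in> cells lam d \<and> (e', f) \<in> cells lam d \<and> e < e'"
    consider "f = b \<and> e = a" | "f = b \<and> e' = a" | "(e, f) \<noteq> (a, b)" "(e', f) \<noteq> (a, b)" by blast
    then show "?t (e, f) < ?t (e', f)"
    proof cases
      case 1
      then show ?thesis using c Mc[of a b e'] below[of e'] by auto
    next
      case 2
      then show ?thesis using c tc[of e b a] lex by auto
    next
      case 3
      then show ?thesis using c tc[of e f e'] by auto
    qed
  qed
  moreover have "t x < M x" using x le[of x] by (simp add: D_def order.strict_iff_order)
  ultimately show ?thesis using cab by (auto simp: ab)
qed

lemma tableau_crosses_update:
  "tableau_crosses lam d (t(x := v)) \<subseteq> insert (v, fst x + snd x - 1) (tableau_crosses lam d t)"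
proof
  fix y assume "y \<in> tableau_crosses lam d (t(x := v))"
  then obtain z where z: "z \<in> cells lam d" "y = ((t(x := v)) z, fst z + snd z - 1)"
    by (auto simp: tableau_crosses_def)
  show "y \<in> insert (v, fst x + snd x - 1) (tableau_crosses lam d t)"
  proof (cases "z = x")
    case False
    then have "y = (t z, fst z + snd z - 1)" using z by simp
    then show ?thesis using z(1) by (auto simp: tableau_crosses_def case_prod_unfold)
  qed (use z in simp)
qed

section \<open>Prism tableaux\<close>

lemma crosses_weight_single:
  assumes "finite X"
  shows "crosses_weight X = Poly_Mapping.single (\<Sum>p\<in>X. Poly_Mapping.single (fst p) 1) 1"
  using assms
proof (induction X rule: finite_induct)
  case (insert p X)
  then show ?case
    by (simp add: crosses_weight_def x_var_def mult_single)
qed (simp add: crosses_weight_def)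

lemma total_degree_crosses_weight:
  assumes "finite X"
  shows "total_degree (crosses_weight X) = card X"
proof -
  let ?e = "\<Sum>p\<in>X. Poly_Mapping.single (fst p) (1::nat)"
  have lk: "Poly_Mapping.lookup ?e m = (\<Sum>p\<in>X. if fst p = m then 1 else 0)" for m
    by (simp add: lookup_sum lookup_single when_def)
  have "(\<Sum>m\<in>Poly_Mapping.keys ?e. Poly_Mapping.lookup ?e m) = (\<Sum>m\<in>fst ` X. Poly_Mapping.lookup ?e m)"
  proof (rule sum.mono_neutral_left)
    show "Poly_Mapping.keys ?e \<subseteq> fst ` X"
    proof
      fix m assume "m \<in> Poly_Mapping.keys ?e"
      then have "Poly_Mapping.lookup ?e m \<noteq> 0" by (simp add: in_keys_iff)
      then have "\<exists>p\<in>X. (if fst p = m then 1 else 0 :: nat) \<noteq> 0"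
        unfolding lk by (rule contrapos_np) (intro sum.neutral, blast)
      then show "m \<in> fst ` X" by (auto split: if_splits)
    qed
  qed (use assms in \<open>auto simp: in_keys_iff\<close>)
  also have "\<dots> = (\<Sum>p\<in>X. \<Sum>m\<in>fst ` X. if fst p = m then 1 else 0)"
    unfolding lk by (rule sum.swap)
  also have "\<dots> = (\<Sum>p\<in>X. 1)" using assms by (intro sum.cong) auto
  finally have "(\<Sum>m\<in>Poly_Mapping.keys ?e. Poly_Mapping.lookup ?e m) = card X" by simp
  then show ?thesis by (simp add: total_degree_def crosses_weight_single[OF assms])
qed

definition prism_crosses :: "nat list list \<Rightarrow> nat list \<Rightarrow> (nat \<times> nat \<Rightarrow> nat) list \<Rightarrow> (nat \<times> nat) set" where
  "prism_crosses lams ds T = (\<Union>c<length lams. tableau_crosses (lams ! c) (ds ! c) (T ! c))"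

lemma has_entry_iff: "has_entry lams ds T s m \<longleftrightarrow> 1 \<le> s \<and> (m, s - 1) \<in> prism_crosses lams ds T"
proof
  assume "has_entry lams ds T s m"
  then obtain c a b where c: "c < length lams" "(a, b) \<in> cells (lams ! c) (ds ! c)" "a + b = s" "(T ! c) (a, b) = m"
    by (auto simp: has_entry_def)
  then have "(m, s - 1) \<in> tableau_crosses (lams ! c) (ds ! c) (T ! c)" by (force simp: tableau_crosses_def)
  then show "1 \<le> s \<and> (m, s - 1) \<in> prism_crosses lams ds T"
    using c by (auto simp: prism_crosses_def cells_def)
next
  assume "1 \<le> s \<and> (m, s - 1) \<in> prism_crosses lams ds T"
  then obtain c a b where c: "c < length lams" "(a, b) \<in> cells (lams ! c) (ds ! c)" "(T ! c) (a, b) = m" "a + b - 1 = s - 1" "1 \<le> s"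
    by (auto simp: prism_crosses_def tableau_crosses_def)
  moreover have "1 \<le> a" using c(2) by (simp add: cells_def)
  ultimately have "a + b = s" by linarith
  then show "has_entry lams ds T s m" unfolding has_entry_def using c by blast
qed

lemma prism_wt_crosses:
  assumes fin: "finite (prism_crosses lams ds T)"
  shows "prism_wt lams ds T = crosses_weight (prism_crosses lams ds T)"
proof -
  let ?X = "prism_crosses lams ds T"
  have "{m. \<exists>s. has_entry lams ds T s m} = fst ` ?X"
  proof (intro equalityI subsetI)
    fix m assume "m \<in> fst ` ?X"
    then obtain a where "(m, a) \<in> ?X" by force
    then have "has_entry lams ds T (Suc a) m" by (simp add: has_entry_iff)
    then show "m \<in> {m. \<exists>s. has_entry lams ds T s m}" by blast
  qed (force simp: has_entry_iff)
  moreover have "antidiag_count lams ds T m = card {p \<in> ?X. fst p = m}" for m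
  proof -
    have "bij_betw (\<lambda>s. (m, s - 1)) {s. has_entry lams ds T s m} {p \<in> ?X. fst p = m}"
      by (rule bij_betwI[where g = "\<lambda>p. Suc (snd p)"]) (auto simp: has_entry_iff)
    then show ?thesis unfolding antidiag_count_def by (rule bij_betw_same_card)
  qed
  moreover have "crosses_weight ?X = (\<Prod>m\<in>fst ` ?X. \<Prod>p\<in>{p \<in> ?X. fst p = m}. x_var (fst p))"
    unfolding crosses_weight_def by (rule prod.image_gen[OF fin])
  moreover have "(\<Prod>p\<in>{p \<in> ?X. fst p = m}. x_var (fst p)) = x_var m ^ card {p \<in> ?X. fst p = m}" for m
  proof -
    have "(\<Prod>p\<in>{p \<in> ?X. fst p = m}. x_var (fst p)) = (\<Prod>p\<in>{p \<in> ?X. fst p = m}. x_var m)"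
      by (rule prod.cong) auto
    then show ?thesis by simp
  qed
  ultimately show ?thesis by (simp add: prism_wt_def)
qed

section \<open>Minimal cross sets and the correspondence with prism tableaux\<close>

locale prism_shapes =
  fixes lams :: "nat list list" and ds :: "nat list" and n :: nat
  assumes nonempty: "lams \<noteq> []"
    and partition: "\<And>c. c < length lams \<Longrightarrow> is_partition (lams ! c)"
    and fits: "\<And>c. c < length lams \<Longrightarrow> part (lams ! c) 1 + ds ! c \<le> n"
begin

abbreviation "shape_tableau c \<equiv> color_tableau (lams ! c) (ds ! c)"
abbreviation "shape_crosses c \<equiv> tableau_crosses (lams ! c) (ds ! c)"
abbreviation "crosses \<equiv> prism_crosses lams ds"
abbreviation "upper_perms \<equiv> perms_above n (prism_asm n lams ds)"
abbreviation "min_length \<equiv> asm_deg n (prism_asm n lams ds)"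

lemma perms_above_prism_asm:
  "upper_perms = {w. w permutes {1..n} \<and> (\<forall>c<length lams. bruhat_le n (grass_perm n (lams ! c) (ds ! c)) w)}"
proof -
  let ?U = "(\<lambda>c. grass_perm n (lams ! c) (ds ! c)) ` {..<length lams}"
  have "prism_asm n lams ds = asm_join n (perm_mat n ` ?U)"
    by (simp add: prism_asm_def image_image)
  moreover have "u permutes {1..n}" if "u \<in> ?U" for u
    using that grass_perm_props(1)[OF partition fits] by auto
  moreover have "?U \<noteq> {}" using nonempty by auto
  ultimately show ?thesis using perms_above_asm_join[of ?U n] by auto
qed

lemma demazure_above_iff:
  assumes "P \<subseteq> staircase n"
  shows "demazure (reading_word n P) \<in> upper_perms \<longleftrightarrow>
    (\<forall>c<length lams. \<exists>t. shape_tableau c t \<and> shape_crosses c t \<subseteq> P)"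
  using grass_perm_le_demazure_iff[OF partition fits assms] demazure_permutes[OF set_reading_word]
  by (simp add: perms_above_prism_asm)

lemma crosses_subset_staircase:
  "prism_tableau lams ds T \<Longrightarrow> crosses T \<subseteq> staircase n"
  using tableau_crosses_subset_staircase[OF _ partition fits] by (force simp: prism_crosses_def prism_tableau_def)

lemma finite_crosses: "prism_tableau lams ds T \<Longrightarrow> finite (crosses T)"
  using crosses_subset_staircase finite_staircase by (rule finite_subset)

lemma finite_upper_perms: "finite upper_perms"
proof (rule finite_subset)
  show "upper_perms \<subseteq> {w. w permutes {1..n}}" by (auto simp: perms_above_prism_asm)
qed (simp add: finite_permutations)

lemma demazure_crosses_above:
  assumes T: "prism_tableau lams ds T"
  shows "demazure (reading_word n (crosses T)) \<in> upper_perms"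
  unfolding demazure_above_iff[OF crosses_subset_staircase[OF T]]
proof (intro allI impI)
  fix c assume c: "c < length lams"
  then have "shape_crosses c (T ! c) \<subseteq> crosses T" by (auto simp: prism_crosses_def)
  then show "\<exists>t. shape_tableau c t \<and> shape_crosses c t \<subseteq> crosses T"
    using T c by (auto simp: prism_tableau_def)
qed

lemma min_length_le_card:
  assumes "P \<subseteq> staircase n" "demazure (reading_word n P) \<in> upper_perms"
  shows "min_length \<le> inv_length n (demazure (reading_word n P))"
    and "inv_length n (demazure (reading_word n P)) \<le> card P"
proof -
  show "min_length \<le> inv_length n (demazure (reading_word n P))"
    unfolding asm_deg_def using finite_upper_perms assms(2) by (intro Min_le) auto
  show "inv_length n (demazure (reading_word n P)) \<le> card P"
    using inv_length_demazure[OF set_reading_word, of n P] length_reading_word[OF assms(1)] by simp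
qed

lemma min_length_le_card_crosses: "prism_tableau lams ds T \<Longrightarrow> min_length \<le> card (crosses T)"
  using min_length_le_card[OF crosses_subset_staircase demazure_crosses_above] by (meson order_trans)

text \<open>Any prism tableau supplies an element, and filling each shape by row indices gives one.
  The minimum defining \<open>asm_deg\<close> is thus attained.\<close>

lemma upper_perms_nonempty: "upper_perms \<noteq> {}"
proof -
  let ?T = "map (\<lambda>c x. if x \<in> cells (lams ! c) (ds ! c) then fst x else 0) [0..<length lams]"
  have "prism_tableau lams ds ?T"
    unfolding prism_tableau_def using color_tableau_row_index by simp
  then show ?thesis using demazure_crosses_above by blast
qed

definition minimal_crosses :: "(nat \<times> nat) set set" where
  "minimal_crosses = {P. P \<subseteq> staircase n \<and> card P = min_length \<and> demazure (reading_word n P) \<in> upper_perms}"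

text \<open>Least length implies Bruhat minimality, because anything strictly below is strictly
  shorter.\<close>

lemma MinPerm_eq: "MinPerm n (prism_asm n lams ds) = {w \<in> upper_perms. inv_length n w = min_length}"
proof (intro equalityI subsetI)
  fix w assume w: "w \<in> {w \<in> upper_perms. inv_length n w = min_length}"
  have "v = w" if v: "v \<in> upper_perms" "bruhat_le n v w" for v
  proof -
    have "min_length \<le> inv_length n v"
      unfolding asm_deg_def using finite_upper_perms v(1) by (intro Min_le) auto
    moreover have "v permutes {1..n}" "w permutes {1..n}" using v w by (simp_all add: perms_above_prism_asm)
    ultimately show ?thesis using bruhat_le_inv_length[of v n w] v(2) w by simp
  qed
  then show "w \<in> MinPerm n (prism_asm n lams ds)" using w by (auto simp: MinPerm_def Perm_def)
qed (simp add: MinPerm_def Perm_def)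

text \<open>For a set of this size the inequalities
  \<open>min_length \<le> inv_length \<le> card P\<close> collapse, so its reading word is reduced
  and its product has least length.\<close>

lemma minimal_crosses_pipe_dreams:
  "minimal_crosses = (\<Union>w\<in>MinPerm n (prism_asm n lams ds). pipe_dreams n w)"
proof (intro equalityI subsetI)
  fix P assume P: "P \<in> minimal_crosses"
  then have "P \<subseteq> staircase n" "demazure (reading_word n P) \<in> upper_perms" "card P = min_length"
    by (simp_all add: minimal_crosses_def)
  moreover from this have "inv_length n (demazure (reading_word n P)) = min_length"
    using min_length_le_card[of P] by simp
  ultimately show "P \<in> (\<Union>w\<in>MinPerm n (prism_asm n lams ds). pipe_dreams n w)"
    by (auto simp: MinPerm_eq pipe_dreams_def)
qed (auto simp: MinPerm_eq pipe_dreams_def minimal_crosses_def)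

lemma minimal_crosses_nonempty: "minimal_crosses \<noteq> {}"
proof -
  have "min_length \<in> inv_length n ` upper_perms"
    unfolding asm_deg_def using finite_upper_perms upper_perms_nonempty by (intro Min_in) auto
  then obtain w where w: "w \<in> upper_perms" "inv_length n w = min_length" by auto
  moreover have "w permutes {1..n}" using w by (simp add: perms_above_prism_asm)
  ultimately show ?thesis
    using pipe_dreams_nonempty[of w n] by (auto simp: minimal_crosses_pipe_dreams MinPerm_eq)
qed

text \<open>The crosses of any prism tableau already number at least \<open>min_length\<close>, so
  no proper subset of \<open>P\<close> can occur.\<close>

lemma crosses_eq_minimal:
  assumes "P \<in> minimal_crosses" "prism_tableau lams ds T" "crosses T \<subseteq> P"
  shows "crosses T = P"
proof (rule card_subset_eq)
  show "finite P" using assms(1) finite_staircase by (auto simp: minimal_crosses_def intro: finite_subset)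
  moreover have "card (crosses T) \<le> card P" using assms(3) \<open>finite P\<close> by (intro card_mono)
  ultimately show "card (crosses T) = card P"
    using min_length_le_card_crosses[OF assms(2)] assms(1) by (simp add: minimal_crosses_def)
qed (rule assms(3))

lemma minimal_prism_iff:
  "minimal_prism lams ds T \<longleftrightarrow> prism_tableau lams ds T \<and> crosses T \<in> minimal_crosses"
proof -
  have td: "total_degree (prism_wt lams ds T) = card (crosses T)" if "prism_tableau lams ds T" for T
    using finite_crosses[OF that] by (simp add: prism_wt_crosses total_degree_crosses_weight)
  have mem: "crosses T \<in> minimal_crosses \<longleftrightarrow> card (crosses T) = min_length" if "prism_tableau lams ds T" for T
    using crosses_subset_staircase[OF that] demazure_crosses_above[OF that] by (simp add: minimal_crosses_def)
  \<comment> \<open>Minimality compares prism tableaux only with each other. Tableaux chosen inside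
    a minimal cross set show that the least degree is \<open>min_length\<close>.\<close>
  obtain P where P: "P \<in> minimal_crosses" using minimal_crosses_nonempty by blast
  then have "\<forall>c<length lams. \<exists>t. shape_tableau c t \<and> shape_crosses c t \<subseteq> P"
    using demazure_above_iff[of P] by (simp add: minimal_crosses_def)
  then obtain t where t: "\<And>c. c < length lams \<Longrightarrow> shape_tableau c (t c) \<and> shape_crosses c (t c) \<subseteq> P"
    by metis
  define T0 where "T0 = map t [0..<length lams]"
  have T0: "prism_tableau lams ds T0" using t by (simp add: prism_tableau_def T0_def)
  have "crosses T0 \<subseteq> P" using t by (auto simp: prism_crosses_def T0_def)
  then have "card (crosses T0) = min_length" using crosses_eq_minimal[OF P T0] P by (simp add: minimal_crosses_def)
  then show ?thesis
    unfolding minimal_prism_def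
    using T0 min_length_le_card_crosses td mem by (metis le_antisym)
qed

text \<open>Take the greatest tableau in every color. The replacement in an unstable triple puts in
  a cross that \<open>P\<close> already contains through color \<open>e\<close>, so it would produce
  a larger tableau with crosses in \<open>P\<close>.\<close>

lemma Prism_exists:
  assumes P: "P \<in> minimal_crosses"
  shows "\<exists>T\<in>Prism lams ds. crosses T = P"
proof -
  have "\<forall>c<length lams. \<exists>t. shape_tableau c t \<and> shape_crosses c t \<subseteq> P"
    using P demazure_above_iff[of P] by (simp add: minimal_crosses_def)
  then have "\<forall>c<length lams. \<exists>M. shape_tableau c M \<and> shape_crosses c M \<subseteq> P \<and>
      (\<forall>t x. shape_tableau c t \<longrightarrow> shape_crosses c t \<subseteq> P \<longrightarrow> t x \<le> M x)"
    using greatest_tableau by blast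
  then obtain M where M: "\<And>c. c < length lams \<Longrightarrow> shape_tableau c (M c) \<and> shape_crosses c (M c) \<subseteq> P"
    and greatest: "\<And>c t x. c < length lams \<Longrightarrow> shape_tableau c t \<Longrightarrow> shape_crosses c t \<subseteq> P \<Longrightarrow> t x \<le> M c x"
    by metis
  define T where "T = map M [0..<length lams]"
  have T: "prism_tableau lams ds T" using M by (simp add: prism_tableau_def T_def)
  have "crosses T \<subseteq> P" using M by (auto simp: prism_crosses_def T_def)
  then have eq: "crosses T = P" by (rule crosses_eq_minimal[OF P T])
  have "\<not> unstable_triple lams ds T"
  proof
    assume "unstable_triple lams ds T"
    then obtain c e p r where c: "c < length lams" "e < length lams" "p \<in> cells (lams ! c) (ds ! c)"
        "r \<in> cells (lams ! e) (ds ! e)" "fst p + snd p = fst r + snd r" "(T ! c) p < (T ! e) r"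
        "prism_tableau lams ds (T[c := (T ! c)(p := (T ! e) r)])"
      unfolding unstable_triple_def by blast
    let ?t = "(T ! c)(p := (T ! e) r)"
    have "shape_tableau c ?t" using c(1,7) by (auto simp: prism_tableau_def)
    moreover have "shape_crosses c ?t \<subseteq> P"
    proof -
      have "((T ! e) r, fst r + snd r - 1) \<in> shape_crosses e (T ! e)"
        using c(4) by (force simp: tableau_crosses_def split: prod.splits)
      then have "((T ! e) r, fst p + snd p - 1) \<in> crosses T"
        using c(2,5) by (auto simp: prism_crosses_def)
      moreover have "shape_crosses c (T ! c) \<subseteq> crosses T" using c(1) by (auto simp: prism_crosses_def)
      ultimately show ?thesis using tableau_crosses_update[of "lams ! c" "ds ! c" "T ! c" p "(T ! e) r"] eq by blast
    qed
    ultimately have "?t p \<le> M c p" by (rule greatest[OF c(1)])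
    then show False using c(1,6) by (simp add: T_def)
  qed
  moreover have "minimal_prism lams ds T" using minimal_prism_iff T eq P by simp
  ultimately show ?thesis using eq by (auto simp: Prism_def)
qed

text \<open>Gives uniqueness: each color of a tableau in \<open>Prism\<close> is determined by the
  cross set alone.\<close>

lemma Prism_color_greatest:
  assumes T: "T \<in> Prism lams ds" and c: "c < length lams"
    and M: "shape_tableau c M" "shape_crosses c M \<subseteq> crosses T"
    and greatest: "\<And>t x. shape_tableau c t \<Longrightarrow> shape_crosses c t \<subseteq> crosses T \<Longrightarrow> t x \<le> M x"
  shows "T ! c = M"
proof (rule ccontr)
  assume neq: "T ! c \<noteq> M"
  have prism: "prism_tableau lams ds T" and min: "crosses T \<in> minimal_crosses"
    using T minimal_prism_iff by (auto simp: Prism_def)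
  have tc: "shape_tableau c (T ! c)" using prism c by (simp add: prism_tableau_def)
  have sub: "shape_crosses e (T ! e) \<subseteq> crosses T" if "e < length lams" for e
    using that by (auto simp: prism_crosses_def)
  obtain x where x: "x \<in> cells (lams ! c) (ds ! c)" "(T ! c) x < M x" "shape_tableau c ((T ! c)(x := M x))"
    using raise_tableau_entry[OF tc M(1) greatest[OF tc sub[OF c]] neq] by blast
  let ?t = "(T ! c)(x := M x)"
  let ?T = "T[c := ?t]"
  have prism': "prism_tableau lams ds ?T"
    using prism x(3) c by (auto simp: prism_tableau_def nth_list_update)
  have "(M x, fst x + snd x - 1) \<in> shape_crosses c M"
    using x(1) by (force simp: tableau_crosses_def split: prod.splits)
  then have in_crosses: "(M x, fst x + snd x - 1) \<in> crosses T" using M(2) by blast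
  \<comment> \<open>The raised value is a cross of \<open>T\<close>, so some color \<open>e\<close>
    shows it on the same antidiagonal; it will be the larger entry of the triple.\<close>
  then obtain e r where e: "e < length lams" "r \<in> cells (lams ! e) (ds ! e)" "(T ! e) r = M x"
      "fst r + snd r - 1 = fst x + snd x - 1"
    by (force simp: prism_crosses_def tableau_crosses_def)
  have pos: "1 \<le> fst y" if "y \<in> cells lam d" for y lam d using that by (auto simp: cells_def)
  have diag: "fst x + snd x = fst r + snd r" using pos[OF x(1)] pos[OF e(2)] e(4) by linarith
  show False
  proof (cases "\<exists>d q. d < length lams \<and> c \<noteq> d \<and> q \<in> cells (lams ! d) (ds ! d) \<and>
      fst x + snd x = fst q + snd q \<and> (T ! c) x = (T ! d) q")
    case True
    then obtain d q where d: "d < length lams" "c \<noteq> d" "q \<in> cells (lams ! d) (ds ! d)"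
      "fst x + snd x = fst q + snd q" "(T ! c) x = (T ! d) q" by blast
    have "prism_tableau lams ds (T[c := (T ! c)(x := (T ! e) r)])" using prism' e(3) by simp
    moreover have "(T ! c) x < (T ! e) r" using x(2) e(3) by simp
    ultimately have "unstable_triple lams ds T"
      unfolding unstable_triple_def using c d e(1,2) x(1) diag by blast
    then show False using T by (simp add: Prism_def)
  next
    case False
    \<comment> \<open>No other color holds the old cross and color \<open>c\<close> held it only
      once, so raising loses it and gains no new one: a proper subset of a minimal set.\<close>
    let ?y = "((T ! c) x, fst x + snd x - 1)"
    have "?y \<notin> crosses ?T"
    proof
      assume "?y \<in> crosses ?T"
      then obtain d q where d: "d < length lams" "q \<in> cells (lams ! d) (ds ! d)" "(?T ! d) q = (T ! c) x"
          "fst q + snd q - 1 = fst x + snd x - 1"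
        by (force simp: prism_crosses_def tableau_crosses_def)
      have diag': "fst x + snd x = fst q + snd q" using pos[OF x(1)] pos[OF d(2)] d(4) by linarith
      show False
      proof (cases "d = c")
        case True
        have "length T = length lams" using prism by (simp add: prism_tableau_def)
        then have upd: "?t q = (T ! c) x" using d(3) True c by simp
        then have "q \<noteq> x" using x(2) by auto
        then have "(T ! c) q = (T ! c) x" using upd by simp
        then have "x = q"
          using color_tableau_antidiagonal_inj[OF tc x(1), of q] d(2) diag' True by simp
        then show False using \<open>q \<noteq> x\<close> by simp
      next
        case d_neq: False
        then have "(T ! d) q = (T ! c) x" using d(3) by simp
        then show False using False d(1,2) diag' d_neq by metis
      qed
    qed
    moreover have "?y \<in> crosses T"
    proof -
      have "?y \<in> shape_crosses c (T ! c)" using x(1) by (force simp: tableau_crosses_def split: prod.splits)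
      then show ?thesis using sub[OF c] by blast
    qed
    moreover have "crosses ?T \<subseteq> crosses T"
    proof -
      have "shape_crosses d (?T ! d) \<subseteq> crosses T" if d: "d < length lams" for d
      proof (cases "d = c")
        case True
        have "length T = length lams" using prism by (simp add: prism_tableau_def)
        then have "?T ! d = ?t" using True c by simp
        then show ?thesis
          using tableau_crosses_update[of "lams ! c" "ds ! c" "T ! c" x "M x"] in_crosses sub[OF c] True by auto
      qed (use sub[OF d] in simp)
      then show ?thesis by (auto simp: prism_crosses_def)
    qed
    ultimately show False using crosses_eq_minimal[OF min prism'] by blast
  qed
qed

lemma bij_betw_Prism: "bij_betw crosses (Prism lams ds) minimal_crosses"
  unfolding bij_betw_def
proof
  show "crosses ` Prism lams ds = minimal_crosses"
    using Prism_exists minimal_prism_iff by (fastforce simp: Prism_def)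
  show "inj_on crosses (Prism lams ds)"
  proof (rule inj_onI)
    fix T T' assume T: "T \<in> Prism lams ds" and T': "T' \<in> Prism lams ds" and eq: "crosses T = crosses T'"
    have prism: "prism_tableau lams ds T" "prism_tableau lams ds T'"
      using T T' by (auto simp: Prism_def minimal_prism_def)
    show "T = T'"
    proof (rule nth_equalityI)
      show "length T = length T'" using prism by (simp add: prism_tableau_def)
      fix c assume "c < length T"
      then have c: "c < length lams" using prism by (simp add: prism_tableau_def)
      then have "shape_tableau c (T ! c)" "shape_crosses c (T ! c) \<subseteq> crosses T"
        using prism(1) by (auto simp: prism_tableau_def prism_crosses_def)
      then obtain M where "shape_tableau c M" "shape_crosses c M \<subseteq> crosses T"
        "\<And>t x. shape_tableau c t \<Longrightarrow> shape_crosses c t \<subseteq> crosses T \<Longrightarrow> t x \<le> M x"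
        using greatest_tableau by metis
      then show "T ! c = T' ! c"
        using Prism_color_greatest[OF T c] Prism_color_greatest[OF T' c] eq by metis
    qed
  qed
qed

theorem prism_poly_eq: "prism_poly lams ds = (\<Sum>w\<in>MinPerm n (prism_asm n lams ds). schubert n w)"
proof -
  have "prism_poly lams ds = (\<Sum>T\<in>Prism lams ds. crosses_weight (crosses T))"
    unfolding prism_poly_def
    by (rule sum.cong[OF refl]) (auto simp: Prism_def minimal_prism_def prism_wt_crosses finite_crosses)
  also have "\<dots> = (\<Sum>P\<in>minimal_crosses. crosses_weight P)"
    by (rule sum.reindex_bij_betw[OF bij_betw_Prism])
  also have "\<dots> = (\<Sum>w\<in>MinPerm n (prism_asm n lams ds). \<Sum>P\<in>pipe_dreams n w. crosses_weight P)"
    unfolding minimal_crosses_pipe_dreams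
  proof (rule sum.UNION_disjoint)
    show "finite (MinPerm n (prism_asm n lams ds))" using finite_upper_perms by (simp add: MinPerm_eq)
    show "\<forall>w\<in>MinPerm n (prism_asm n lams ds). finite (pipe_dreams n w)"
      using finite_staircase by (auto simp: pipe_dreams_def intro: finite_subset[of _ "Pow (staircase n)"])
  qed (auto simp: pipe_dreams_def)
  also have "\<dots> = (\<Sum>w\<in>MinPerm n (prism_asm n lams ds). schubert n w)"
    by (rule sum.cong[OF refl]) (auto simp: MinPerm_eq perms_above_prism_asm schubert_pipe_dreams)
  finally show ?thesis .
qed

end

theorem theorem1p1:
  fixes lams :: "nat list list" and ds :: "nat list" and n :: nat
  assumes "lams \<noteq> []"
    and "length ds = length lams"
    and "\<And>c. c < length lams \<Longrightarrow> is_partition (lams ! c)"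
    and "\<And>c. c < length lams \<Longrightarrow> ds ! c > 0"
    and "\<And>c. c < length lams \<Longrightarrow> length (lams ! c) \<le> ds ! c"
    and "\<And>c. c < length lams \<Longrightarrow> part (lams ! c) 1 + ds ! c \<le> n"
  shows "prism_poly lams ds = (\<Sum>w\<in>MinPerm n (prism_asm n lams ds). schubert n w)"
proof -
  interpret prism_shapes lams ds n by unfold_locales (use assms in auto)
  show ?thesis by (rule prism_poly_eq)
qed

end
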